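(* There is an absolute constant $C>0$ and, for every $\alpha\in(0,1]$, a constant $C_\alpha>0$ depending only on $\alpha$, such that the following holds. Let $d\in\mathbb{N}$, $d\ge 2$, and $\alpha\in(0,1]$. Then there is $\varepsilon_0=\varepsilon_0(d,\alpha)\in(0,1]$ such that for every $\varepsilon\in(0,\varepsilon_0)$ one can explicitly construct a deep neural network architecture $\mathbb{A}_\varepsilon$ (independent of $f$) with the following property: for every $f\in\mathring{U}^{\alpha,d}_\infty$ one can explicitly construct a deep ReLU neural network $\Phi_\varepsilon(f)$ having the architecture $\mathbb{A}_\varepsilon$ such that $$\|f-\Phi_\varepsilon(f)\|_{\infty}\le\varepsilon .$$ Moreover, $$W(\mathbb{A}_\varepsilon)\le C_\alpha\, d\left(\frac{K_1^d}{(d-1)!}\right)^{\frac1\alpha+1}\varepsilon^{-\frac1\alpha}\,\big(\log(2\varepsilon^{-1})\big)^{(d-1)(\frac1\alpha+1)+1}$$ and $$L(\mathbb{A}_\varepsilon)\le C\,\log d\,\log(2\varepsilon^{-1}),$$ where $K_1=B^{1/(\alpha+1)}\,4\alpha^{-1}$ and $B=(2^\alpha-1)^{-1}$.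
   Context: Notation: $\mathbb{I}=[0,1]$, $\mathbb{I}^d=[0,1]^d$, $\|\cdot\|_\infty$ is the norm of $L_\infty(\mathbb{I}^d)$, $\log$ is the logarithm to base 2. Function class. For $u\subset\{1,\dots,d\}$ and $\boldsymbol h=(h_1,\dots,h_d)$ with positive entries, $\Delta_{\boldsymbol h,u}:=\prod_{i\in u}\Delta_{h_i}$, $\Delta_{\boldsymbol h,\varnothing}:=\mathrm{Id}$, where $\Delta_{h_i}$ is the first difference $g\mapsto g(\cdot+h_i)-g(\cdot)$ applied in the variable $x_i$ with the other variables fixed. For $0<\alpha\le1$ and $f\in C(\mathbb{I}^d)$ put $$|f|_{H^\alpha_\infty(u)}:=\sup_{\boldsymbol h>0}\ \prod_{i\in u}h_i^{-\alpha}\,\|\Delta_{\boldsymbol h,u}(f)\|_{C(\mathbb{I}^d(\boldsymbol h,u))},\qquad \mathbb{I}^d(\boldsymbol h,u):=\{\boldsymbol x\in\mathbb{I}^d:\ x_i+h_i\in\mathbb{I},\ i\in u\}$$ (the sup norm over an empty set is $0$; $|f|_{H^\alpha_\infty(\varnothing)}=\|f\|_{C(\mathbb{I}^d)}$). $H^\alpha_\infty(\mathbb{I}^d)$ is the set of $f\in C(\mathbb{I}^d)$ with finite norm $\|f\|_{H^\alpha_\infty(\mathbb{I}^d)}:=\max_{u\subset\{1,\dots,d\}}|f|_{H^\alpha_\infty(u)}$. $\mathring{C}(\mathbb{I}^d)$ is the set of $f\in C(\mathbb{I}^d)$ vanishing on the boundary of $\mathbb{I}^d$. $\mathring{U}^{\alpha,d}_\infty$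 is the set of $f\in H^\alpha_\infty(\mathbb{I}^d)\cap\mathring{C}(\mathbb{I}^d)$ with $\|f\|_{H^\alpha_\infty(\mathbb{I}^d)}\le1$. Neural networks. A neural network with input dimension $d$ and $L\ge2$ layers is a sequence $\Phi=((\boldsymbol W^1,\boldsymbol b^1),\dots,(\boldsymbol W^L,\boldsymbol b^L))$, where $\boldsymbol W^\ell=(w^\ell_{i,j})$ is a real $N_\ell\times N_{\ell-1}$ matrix, $\boldsymbol b^\ell\in\mathbb{R}^{N_\ell}$, $N_0=d$, $N_1,\dots,N_L\in\mathbb{N}$. Its depth is $L(\Phi)=L$, its dimension is $\boldsymbol N(\Phi)=(N_0,\dots,N_L)$, and its size $W(\Phi)$ is the number of nonzero entries of all $\boldsymbol W^\ell$ and $\boldsymbol b^\ell$. It is called deep if $L(\Phi)\ge3$. A (deep) ReLU neural network computes, with $\sigma(t)=\max\{t,0\}$ applied coordinatewise, $\boldsymbol z^0=\boldsymbol x\in\mathbb{R}^d$, $\boldsymbol z^\ell=\sigma(\boldsymbol W^\ell\boldsymbol z^{\ell-1}+\boldsymbol b^\ell)$ for $\ell=1,\dots,L-1$, and $\boldsymbol z^L=\boldsymbol W^L\boldsymbol z^{L-1}+\boldsymbol b^L$; the output is $\Phi(\boldsymbol x):=\boldsymbol z^L$, and a network is identified with its output function. A neural network architecture $\mathbb{A}=((\overline{\boldsymbol W}^1,\overline{\boldsymbol b}^1),\dots,(\overline{\boldsymbol W}^L,\overline{\boldsymbol b}^L))$ is a neural network all of whose entries $\overline w^\ell_{i,j},\overline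 b^\ell_i$ are in $\{0,1\}$; its size $W(\mathbb{A})$ is the number of nonzero entries of all $\overline{\boldsymbol W}^\ell$ and $\overline{\boldsymbol b}^\ell$, its depth $L(\mathbb{A})=L$ is its number of layers, and its dimension is $\boldsymbol N(\mathbb{A})=(N_0,\dots,N_L)$, where $\overline{\boldsymbol W}^\ell$ is an $N_\ell\times N_{\ell-1}$ matrix. A network $\Phi$ has architecture $\mathbb{A}$ if $\boldsymbol N(\Phi)=\boldsymbol N(\mathbb{A})$ and $\overline w^\ell_{i,j}=0$ implies $w^\ell_{i,j}=0$, and $\overline b^\ell_i=0$ implies $b^\ell_i=0$, for all $i,j,\ell$. *)

theory Defs
  imports "HOL-Probability.Probability" "Jordan_Normal_Form.Matrix"
begin

(* Both HOL-Analysis and Jordan_Normal_Form provide a type vec and the infix $.  Below, vec and $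
   are those of Jordan_Normal_Form: the dimension is a natural number, not a type. *)
unbundle no vec_syntax

text \<open>Coordinates are numbered from \<open>0\<close>, so that \<open>{..<d}\<close> stands for \<open>{1,\<dots>,d}\<close>.
  A function on the cube is a total function on \<^typ>\<open>real vec\<close>; all notions below
  only depend on its values on the cube.\<close>

definition cube :: "nat \<Rightarrow> real vec set" where
  "cube d = {x \<in> carrier_vec d. \<forall>i<d. x $ i \<in> {0..1}}"

text \<open>Jordan_Normal_Form puts no topology on its vectors; this is the Euclidean topology on the
  vectors of dimension \<open>d\<close>, as a finite product of real lines.\<close>

definition vec_topology :: "nat \<Rightarrow> real vec topology" where
  "vec_topology d = pullback_topology (carrier_vec d) (\<lambda>x. restrict (\<lambda>i. x $ i) {..<d})
     (product_topology (\<lambda>_. euclideanreal) {..<d})"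

definition C_cube :: "nat \<Rightarrow> (real vec \<Rightarrow> real) set" where
  "C_cube d = {f. continuous_map (subtopology (vec_topology d) (cube d)) euclideanreal f}"

definition C0_cube :: "nat \<Rightarrow> (real vec \<Rightarrow> real) set" where
  "C0_cube d = {f \<in> C_cube d. \<forall>x \<in> vec_topology d frontier_of cube d. f x = 0}"

definition sup_norm_on :: "real vec set \<Rightarrow> (real vec \<Rightarrow> real) \<Rightarrow> ennreal" where
  "sup_norm_on S g = (SUP x\<in>S. ennreal \<bar>g x\<bar>)"

text \<open>The norm of \<open>L\<^sub>\<infinity>\<close> on the cube, with respect to Lebesgue measure.\<close>

definition Linf_norm :: "nat \<Rightarrow> (real vec \<Rightarrow> real) \<Rightarrow> ennreal" where
  "Linf_norm d g = esssup (Pi\<^sub>M {..<d} (\<lambda>_. restrict_space lborel {0..1::real}))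
     (\<lambda>x. ennreal \<bar>g (vec d x)\<bar>)"

definition diff1 :: "nat \<Rightarrow> real vec \<Rightarrow> nat \<Rightarrow> (real vec \<Rightarrow> real) \<Rightarrow> real vec \<Rightarrow> real" where
  "diff1 d h i g = (\<lambda>x. g (x + h $ i \<cdot>\<^sub>v unit_vec d i) - g x)"

text \<open>The operators \<^term>\<open>diff1 d h i\<close> commute, so the order of composition is immaterial.\<close>

definition mixed_diff :: "nat \<Rightarrow> real vec \<Rightarrow> nat set \<Rightarrow> (real vec \<Rightarrow> real) \<Rightarrow> real vec \<Rightarrow> real" where
  "mixed_diff d h u = foldr (diff1 d h) (sorted_list_of_set u)"

definition shifted_cube :: "nat \<Rightarrow> real vec \<Rightarrow> nat set \<Rightarrow> real vec set" where
  "shifted_cube d h u = {x \<in> cube d. \<forall>i\<in>u. x $ i + h $ i \<in> {0..1}}"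

definition holder_seminorm :: "nat \<Rightarrow> real \<Rightarrow> nat set \<Rightarrow> (real vec \<Rightarrow> real) \<Rightarrow> ennreal" where
  "holder_seminorm d \<alpha> u f =
     (SUP h\<in>{h \<in> carrier_vec d. \<forall>i<d. h $ i > 0}.
        ennreal (\<Prod>i\<in>u. (h $ i) powr (- \<alpha>)) * sup_norm_on (shifted_cube d h u) (mixed_diff d h u f))"

definition holder_norm :: "nat \<Rightarrow> real \<Rightarrow> (real vec \<Rightarrow> real) \<Rightarrow> ennreal" where
  "holder_norm d \<alpha> f = Max ((\<lambda>u. holder_seminorm d \<alpha> u f) ` Pow {..<d})"

definition holder_space :: "nat \<Rightarrow> real \<Rightarrow> (real vec \<Rightarrow> real) set" where
  "holder_space d \<alpha> = {f \<in> C_cube d. holder_norm d \<alpha> f < \<infinity>}"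

definition U0_ball :: "nat \<Rightarrow> real \<Rightarrow> (real vec \<Rightarrow> real) set" where
  "U0_ball d \<alpha> = {f \<in> holder_space d \<alpha> \<inter> C0_cube d. holder_norm d \<alpha> f \<le> 1}"

type_synonym network = "(real mat \<times> real vec) list"

text \<open>The list \<open>[N\<^sub>0, \<dots>, N\<^sub>L]\<close>.  The matrix \<open>W\<^sup>l\<close> is the first component of the list entry with index \<open>l - 1\<close>.\<close>

definition net_dims :: "network \<Rightarrow> nat list" where
  "net_dims \<Phi> = dim_col (fst (hd \<Phi>)) # map (\<lambda>(W, b). dim_row W) \<Phi>"

definition net_depth :: "network \<Rightarrow> nat" where
  "net_depth \<Phi> = length \<Phi>"

definition is_network :: "nat \<Rightarrow> network \<Rightarrow> bool" where
  "is_network d \<Phi> \<longleftrightarrow> net_depth \<Phi> \<ge> 2 \<and> net_dims \<Phi> ! 0 = d \<and>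
     (\<forall>l < net_depth \<Phi>.
        fst (\<Phi> ! l) \<in> carrier_mat (net_dims \<Phi> ! Suc l) (net_dims \<Phi> ! l) \<and>
        snd (\<Phi> ! l) \<in> carrier_vec (net_dims \<Phi> ! Suc l) \<and>
        net_dims \<Phi> ! Suc l \<ge> 1)"

definition is_deep :: "network \<Rightarrow> bool" where
  "is_deep \<Phi> \<longleftrightarrow> net_depth \<Phi> \<ge> 3"

definition net_size :: "network \<Rightarrow> nat" where
  "net_size \<Phi> = (\<Sum>l < net_depth \<Phi>.
     card {(i, j). i < dim_row (fst (\<Phi> ! l)) \<and> j < dim_col (fst (\<Phi> ! l)) \<and> fst (\<Phi> ! l) $$ (i, j) \<noteq> 0} +
     card {i. i < dim_vec (snd (\<Phi> ! l)) \<and> snd (\<Phi> ! l) $ i \<noteq> 0})"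

definition relu :: "real \<Rightarrow> real" where
  "relu t = max t 0"

text \<open>No activation is applied in the last layer.  The first equation is only a default value,
  since networks have at least two layers.\<close>

fun relu_output :: "network \<Rightarrow> real vec \<Rightarrow> real vec" where
  "relu_output [] x = x"
| "relu_output [(W, b)] x = W *\<^sub>v x + b"
| "relu_output ((W, b) # layer # \<Phi>) x = relu_output (layer # \<Phi>) (map_vec relu (W *\<^sub>v x + b))"

definition is_architecture :: "nat \<Rightarrow> network \<Rightarrow> bool" where
  "is_architecture d A \<longleftrightarrow> is_network d A \<and>
     (\<forall>l < net_depth A. elements_mat (fst (A ! l)) \<subseteq> {0, 1} \<and> set\<^sub>v (snd (A ! l)) \<subseteq> {0, 1})"

definition has_architecture :: "network \<Rightarrow> network \<Rightarrow> bool" where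
  "has_architecture \<Phi> A \<longleftrightarrow> net_dims \<Phi> = net_dims A \<and>
     (\<forall>l < net_depth A.
        (\<forall>i < dim_row (fst (A ! l)). \<forall>j < dim_col (fst (A ! l)).
           fst (A ! l) $$ (i, j) = 0 \<longrightarrow> fst (\<Phi> ! l) $$ (i, j) = 0) \<and>
        (\<forall>i < dim_vec (snd (A ! l)). snd (A ! l) $ i = 0 \<longrightarrow> snd (\<Phi> ! l) $ i = 0))"

definition B_const :: "real \<Rightarrow> real" where
  "B_const \<alpha> = inverse (2 powr \<alpha> - 1)"

definition K1_const :: "real \<Rightarrow> real" where
  "K1_const \<alpha> = B_const \<alpha> powr (1 / (\<alpha> + 1)) * 4 * inverse \<alpha>"

end

theory Submission
  imports Defs "HOL-Real_Asymp.Real_Asymp"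
begin

text \<open>A function of the unit ball is expanded in tensor products of Faber hat functions, truncated to a sparse
  grid: with mixed smoothness \<open>\<alpha>\<close>, keeping the levels \<open>k\<close> with \<open>|k| \<le> m\<close> leaves an error of at most
  \<open>2 powr (- \<alpha> * (m + 1))\<close> times \<open>m + d choose d - 1\<close>, while the number of terms is at most \<open>2 ^ (m + 1)\<close> times
  \<open>m + d - 1 choose d - 1\<close>.  Only the coefficients depend on the function, and they become the weights of the last
  layer of the network.

  A hat function is an exact two-layer network.  A product of \<open>d\<close> hats is evaluated along a binary tree of
  approximate multiplications, obtained by polarization from the piecewise linear interpolation of the parabola by
  iterated tent maps.  The approximate product vanishes whenever a factor does, so at every point only one term
  per level \<open>k\<close> contributes to the error.  Hence an accuracy of \<open>\<epsilon>\<^sup>2\<close> per multiplication is enough, whatever \<open>\<alpha>\<close>,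
  and the depth is of order \<open>log d * log (2 / \<epsilon>)\<close>.\<close>

section \<open>Faber interpolation in one variable\<close>

text \<open>The constants may depend on \<alpha> only, while the comparison of powers of
  \<open>m\<close> with exponentials depends on \<open>d\<close>. All such comparisons are therefore
  pushed into the choice of \<open>\<epsilon>\<^sub>0\<close>. In particular, for \<epsilon> below
  it, \<open>d * (m + 1) ^ d\<close> is at most 1/\<epsilon>; this number controls how often a
  multiplication error is felt at one point, and so makes the accuracy of order \<epsilon>^2
  sufficient. The level \<open>m\<close> is the least one with truncation error at most
  \<epsilon>/2. Minimality bounds \<open>2 powr (\<alpha> * m)\<close> by 2/\<epsilon> times a
  binomial coefficient, so \<open>2 ^ m\<close> carries that coefficient to the power 1/\<alpha>.
  The grid size has the same coefficient once more as a factor: hence the exponent 1/\<alpha> + 1 of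
  the factorial and of the logarithm. The one additional logarithm in the size is the cost of a
  single multiplication. The error is measured by an essential supremum, so besides a pointwise
  bound the measurability of the function and of the network is required.\<close>

definition hat :: "real \<Rightarrow> real" where
  "hat t = relu (1 - relu t - relu (- t))"

lemma hat_eq: "hat t = max 0 (1 - \<bar>t\<bar>)"
  by (auto simp: hat_def relu_def max_def)

lemma hat_range: "0 \<le> hat t" "hat t \<le> 1"
  by (auto simp: hat_eq)

text \<open>The pair \<open>(k, s)\<close> stands for the cell [s/2^k, (s+1)/2^k], and the hat peaks
  at its midpoint. Level 0 is one hat over the whole interval; there are no hats at 0 and 1, since
  the functions to be expanded vanish there.\<close>

fun faber :: "nat \<times> nat \<Rightarrow> real \<Rightarrow> real" where
  "faber (k, s) t = hat (2 ^ Suc k * t - (2 * real s + 1))"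

text \<open>The hierarchical surplus: the value at the midpoint of the cell minus that of the linear
  interpolant, that is, -1/2 times a second difference with step 1/2^(k+1).\<close>

fun faber_coeff :: "nat \<times> nat \<Rightarrow> (real \<Rightarrow> real) \<Rightarrow> real" where
  "faber_coeff (k, s) g = g (real (2 * s + 1) / 2 ^ Suc k) - (g (real s / 2 ^ k) + g (real (Suc s) / 2 ^ k)) / 2"

lemma faber_range: "0 \<le> faber p t" "faber p t \<le> 1"
  by (cases p; simp add: hat_range)+

lemma faber_neq_0_iff: "faber (k, s) t \<noteq> 0 \<longleftrightarrow> real s < 2 ^ k * t \<and> 2 ^ k * t < real (Suc s)"
  by (auto simp: hat_eq max_def abs_if)

lemma faber_unique: "faber (k, s) t \<noteq> 0 \<Longrightarrow> faber (k, s') t \<noteq> 0 \<Longrightarrow> s = s'"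
  unfolding faber_neq_0_iff by (smt (verit) less_Suc_eq_le not_less_eq of_nat_less_iff order_less_trans linorder_neqE_nat)

text \<open>The supports of one level are disjoint open cells. At a common endpoint of two cells
  every hat of the level vanishes, which is why closed inequalities are enough and either cell may
  be named.\<close>

lemma sum_faber_at_cell:
  assumes "s < 2 ^ k" "real s \<le> 2 ^ k * t" "2 ^ k * t \<le> real (Suc s)"
  shows "(\<Sum>i<2^k. faber (k, i) t * c i) = faber (k, s) t * c s"
proof -
  have z: "faber (k, i) t = 0" if "i \<noteq> s" for i
  proof (rule ccontr)
    assume "faber (k, i) t \<noteq> 0"
    then have "real i < 2 ^ k * t" "2 ^ k * t < real (Suc i)" by (auto simp only: faber_neq_0_iff)
    then have "real i < real (Suc s)" "real s < real (Suc i)" using assms by linarith+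
    then show False using that by simp
  qed
  show ?thesis
    using assms(1) by (subst sum.remove[of _ s]) (auto simp: z simp del: faber.simps intro!: sum.neutral)
qed

lemma dyadic_cell:
  assumes "t \<in> {0..1::real}"
  obtains s where "s < 2 ^ n" "real s \<le> 2 ^ n * t" "2 ^ n * t \<le> real (Suc s)"
proof (cases "t = 1")
  case True
  \<comment> \<open>The floor used below would give the index \<open>2 ^ n\<close>, one past the
    last cell.\<close>
  show ?thesis by (rule that[of "2 ^ n - 1"]) (auto simp: True of_nat_diff)
next
  case False
  show ?thesis
  proof (rule that[of "nat \<lfloor>2 ^ n * t\<rfloor>"])
    have "2 ^ n * t < 2 ^ n * 1" using assms False by (intro mult_strict_left_mono) auto
    then have "\<lfloor>2 ^ n * t\<rfloor> < 2 ^ n" by (simp add: floor_less_iff)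
    then show "nat \<lfloor>2 ^ n * t\<rfloor> < 2 ^ n" by (simp add: nat_less_iff)
    show "real (nat \<lfloor>2 ^ n * t\<rfloor>) \<le> 2 ^ n * t" "2 ^ n * t \<le> real (Suc (nat \<lfloor>2 ^ n * t\<rfloor>))"
      using assms by auto linarith+
  qed
qed

text \<open>The partial sum is the piecewise linear interpolant on the grid of width 1/2^n. Passing
  to level n + 1, the cell \<open>s\<close> is one half of the cell \<open>r = s div 2\<close>; on
  it the only new hat is linear and corrects the value at the midpoint of \<open>r\<close>. The
  boundary values of \<open>g\<close> enter at n = 0.\<close>

lemma faber_partial_sum:
  assumes "g 0 = 0" "g 1 = 0" "s < 2 ^ n" "real s \<le> 2 ^ n * t" "2 ^ n * t \<le> real (Suc s)"
  shows "(\<Sum>k<n. \<Sum>i<2^k. faber (k, i) t * faber_coeff (k, i) g)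
     = (real (Suc s) - 2 ^ n * t) * g (real s / 2 ^ n) + (2 ^ n * t - real s) * g (real (Suc s) / 2 ^ n)"
  using assms(3-5)
proof (induction n arbitrary: s)
  case 0
  then show ?case using assms by simp
next
  case (Suc n)
  define r where "r = s div 2"
  define y where "y = 2 ^ n * t"
  have r: "r < 2 ^ n" using Suc.prems(1) by (simp add: r_def less_mult_imp_div_less mult.commute)
  consider "s = 2 * r" | "s = 2 * r + 1" unfolding r_def by linarith
  then show ?case
  proof cases
    case 1
    have b: "real r \<le> y" "2 * y \<le> 2 * real r + 1" using Suc.prems 1 by (auto simp: y_def)
    have h: "faber (n, r) t = 2 * y - 2 * real r" using b by (auto simp: hat_eq y_def)
    have e: "real s / 2 ^ Suc n = real r / 2 ^ n" "real (Suc s) = real (2 * r + 1)" "2 ^ Suc n * t = 2 * y"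
      using 1 by (auto simp: y_def)
    have "(\<Sum>k<n. \<Sum>i<2^k. faber (k, i) t * faber_coeff (k, i) g)
       = (real (Suc r) - y) * g (real r / 2 ^ n) + (y - real r) * g (real (Suc r) / 2 ^ n)"
      unfolding y_def by (rule Suc.IH) (use r b in \<open>auto simp: y_def\<close>)
    moreover have "(\<Sum>i<2^n. faber (n, i) t * faber_coeff (n, i) g) = faber (n, r) t * faber_coeff (n, r) g"
      by (rule sum_faber_at_cell) (use r b in \<open>auto simp: y_def\<close>)
    ultimately show ?thesis
      unfolding sum.lessThan_Suc h e using 1 by (simp add: field_simps)
  next
    case 2
    have b: "y \<le> real (Suc r)" "2 * real r + 1 \<le> 2 * y" using Suc.prems 2 by (auto simp: y_def)
    have h: "faber (n, r) t = 2 * real r + 2 - 2 * y" using b by (auto simp: hat_eq y_def)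
    have e: "real (Suc s) / 2 ^ Suc n = real (Suc r) / 2 ^ n" "real s = real (2 * r + 1)" "2 ^ Suc n * t = 2 * y"
      using 2 by (auto simp: y_def field_simps)
    have "(\<Sum>k<n. \<Sum>i<2^k. faber (k, i) t * faber_coeff (k, i) g)
       = (real (Suc r) - y) * g (real r / 2 ^ n) + (y - real r) * g (real (Suc r) / 2 ^ n)"
      unfolding y_def by (rule Suc.IH) (use r b in \<open>auto simp: y_def\<close>)
    moreover have "(\<Sum>i<2^n. faber (n, i) t * faber_coeff (n, i) g) = faber (n, r) t * faber_coeff (n, r) g"
      by (rule sum_faber_at_cell) (use r b in \<open>auto simp: y_def\<close>)
    ultimately show ?thesis
      unfolding sum.lessThan_Suc h e using 2 by (simp add: field_simps)
  qed
qed

text \<open>The weights of the interpolant at the two ends of the cell sum to 1, so the error is a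
  convex combination of two increments of \<open>g\<close> inside one cell.\<close>

lemma faber_error:
  fixes \<alpha> c :: real
  assumes "\<alpha> \<ge> 0" "c \<ge> 0" "g 0 = 0" "g 1 = 0" "t \<in> {0..1}"
    and hoelder: "\<And>t h. 0 < h \<Longrightarrow> 0 \<le> t \<Longrightarrow> t + h \<le> 1 \<Longrightarrow> \<bar>g (t + h) - g t\<bar> \<le> c * h powr \<alpha>"
  shows "\<bar>g t - (\<Sum>k<n. \<Sum>i<2^k. faber (k, i) t * faber_coeff (k, i) g)\<bar> \<le> c * 2 powr (- \<alpha> * real n)"
proof -
  obtain s where s: "s < 2 ^ n" "real s \<le> 2 ^ n * t" "2 ^ n * t \<le> real (Suc s)"
    using dyadic_cell[OF assms(5)] .
  let ?a = "real s / 2 ^ n" and ?b = "real (Suc s) / 2 ^ n" and ?h = "1 / 2 ^ n :: real"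
  have ab: "0 \<le> ?a" "?a \<le> t" "t \<le> ?b" "?b \<le> 1" "?b - ?a = ?h"
    using s by (auto simp: field_simps simp flip: of_nat_Suc) 
  have H: "\<bar>g v - g u\<bar> \<le> c * ?h powr \<alpha>" if "0 \<le> u" "u \<le> v" "v \<le> 1" "v - u \<le> ?h" for u v
  proof (cases "u = v")
    case False
    have "\<bar>g (u + (v - u)) - g u\<bar> \<le> c * (v - u) powr \<alpha>" using that False by (intro hoelder) auto
    also have "\<dots> \<le> c * ?h powr \<alpha>" using that False assms by (intro mult_left_mono powr_mono2) auto
    finally show ?thesis by simp
  qed (use assms in auto)
  have Ha: "\<bar>g t - g ?a\<bar> \<le> c * ?h powr \<alpha>" and Hb: "\<bar>g t - g ?b\<bar> \<le> c * ?h powr \<alpha>"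
    using H[of ?a t] H[of t ?b] ab by linarith+
  let ?p = "real (Suc s) - 2 ^ n * t" and ?q = "2 ^ n * t - real s"
  have "\<bar>g t - (\<Sum>k<n. \<Sum>i<2^k. faber (k, i) t * faber_coeff (k, i) g)\<bar>
     = \<bar>?p * (g t - g ?a) + ?q * (g t - g ?b)\<bar>"
    unfolding faber_partial_sum[OF assms(3,4) s] by (simp add: algebra_simps)
  also have "\<dots> \<le> ?p * \<bar>g t - g ?a\<bar> + ?q * \<bar>g t - g ?b\<bar>"
    using s by (intro order.trans[OF abs_triangle_ineq]) (simp add: abs_mult)
  also have "\<dots> \<le> ?p * (c * ?h powr \<alpha>) + ?q * (c * ?h powr \<alpha>)"
    using s Ha Hb by (intro add_mono mult_left_mono) auto
  also have "\<dots> = c * ?h powr \<alpha>" by (simp add: algebra_simps)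
  also have "?h powr \<alpha> = 2 powr (- \<alpha> * real n)"
    by (simp add: powr_divide powr_minus powr_realpow[symmetric] powr_powr field_simps)
  finally show ?thesis .
qed

declare faber.simps [simp del] faber_coeff.simps [simp del]

section \<open>Sparse-grid interpolation\<close>

text \<open>Recursion over the coordinates: each coordinate is either frozen at a point or differenced, at the
  price of a factor \<open>h powr \<alpha>\<close>.  Thus \<open>c\<close> bounds all mixed seminorms at once.\<close>

fun hoelder_mix :: "real \<Rightarrow> nat \<Rightarrow> real \<Rightarrow> (real list \<Rightarrow> real) \<Rightarrow> bool" where
  "hoelder_mix \<alpha> 0 c f \<longleftrightarrow> \<bar>f []\<bar> \<le> c"
| "hoelder_mix \<alpha> (Suc n) c f \<longleftrightarrow> (\<forall>t\<in>{0..1}. hoelder_mix \<alpha> n c (\<lambda>xs. f (t # xs))) \<and>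
     (\<forall>t h. 0 < h \<longrightarrow> 0 \<le> t \<longrightarrow> t + h \<le> 1 \<longrightarrow>
        hoelder_mix \<alpha> n (c * h powr \<alpha>) (\<lambda>xs. f ((t + h) # xs) - f (t # xs)))"

definition vanishing :: "nat \<Rightarrow> (real list \<Rightarrow> real) \<Rightarrow> bool" where
  "vanishing n f \<longleftrightarrow>
     (\<forall>xs. length xs = n \<longrightarrow> set xs \<subseteq> {0..1} \<longrightarrow> 0 \<in> set xs \<or> 1 \<in> set xs \<longrightarrow> f xs = 0)"

lemma hoelder_mix_bound:
  "hoelder_mix \<alpha> n c f \<Longrightarrow> length xs = n \<Longrightarrow> set xs \<subseteq> {0..1} \<Longrightarrow> \<bar>f xs\<bar> \<le> c"
proof (induction n arbitrary: f xs)
  case (Suc n)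
  then obtain t ys where xs: "xs = t # ys" "length ys = n" by (auto simp: length_Suc_conv)
  then show ?case using Suc.IH[of "\<lambda>ys. f (t # ys)" ys] Suc.prems by auto
qed auto

lemma hoelder_mix_cong:
  "(\<And>xs. length xs = n \<Longrightarrow> f xs = g xs) \<Longrightarrow> hoelder_mix \<alpha> n c f \<longleftrightarrow> hoelder_mix \<alpha> n c g"
proof (induction n arbitrary: c f g)
  case (Suc n)
  have "hoelder_mix \<alpha> n c (\<lambda>xs. f (t # xs)) \<longleftrightarrow> hoelder_mix \<alpha> n c (\<lambda>xs. g (t # xs))"
    and "hoelder_mix \<alpha> n c (\<lambda>xs. f (s # xs) - f (t # xs)) \<longleftrightarrow> hoelder_mix \<alpha> n c (\<lambda>xs. g (s # xs) - g (t # xs))"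
    for c s t using Suc.prems by (intro Suc.IH; simp)+
  then show ?case by simp
qed auto

text \<open>Halving compensates the doubling caused by the triangle inequality, so the constant
  survives; this is the shape in which Faber coefficients arise.\<close>

lemma hoelder_mix_half_diff:
  "hoelder_mix \<alpha> n c f \<Longrightarrow> hoelder_mix \<alpha> n c g \<Longrightarrow> hoelder_mix \<alpha> n c (\<lambda>xs. (f xs - g xs) / 2)"
proof (induction n arbitrary: c f g)
  case (Suc n)
  show ?case
    unfolding hoelder_mix.simps
  proof (intro conjI ballI allI impI)
    fix t h :: real assume "0 < h" "0 \<le> t" "t + h \<le> 1"
    then have "hoelder_mix \<alpha> n (c * h powr \<alpha>)
        (\<lambda>xs. ((f ((t + h) # xs) - f (t # xs)) - (g ((t + h) # xs) - g (t # xs))) / 2)"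
      using Suc.prems by (intro Suc.IH) auto
    then show "hoelder_mix \<alpha> n (c * h powr \<alpha>)
        (\<lambda>xs. (f ((t + h) # xs) - g ((t + h) # xs)) / 2 - (f (t # xs) - g (t # xs)) / 2)"
      by (rule back_subst[of "hoelder_mix \<alpha> n (c * h powr \<alpha>)"]) (auto simp: field_simps)
  qed (use Suc in auto)
qed auto

text \<open>A coefficient is half the difference of two consecutive first differences with step h =
  1/2^(k+1), and each of them has constant \<open>c * h powr \<alpha>\<close> in the remaining
  coordinates.\<close>

lemma hoelder_mix_faber_coeff:
  assumes "hoelder_mix \<alpha> (Suc n) c f" "s < 2 ^ k"
  shows "hoelder_mix \<alpha> n (c * 2 powr (- \<alpha> * real (Suc k))) (\<lambda>xs. faber_coeff (k, s) (\<lambda>t. f (t # xs)))"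
proof -
  define h :: real where "h = 1 / 2 ^ Suc k"
  have h: "0 < h" by (simp add: h_def)
  have hp: "h powr \<alpha> = 2 powr (- \<alpha> * real (Suc k))"
    by (simp add: h_def powr_divide powr_minus powr_realpow[symmetric] powr_powr field_simps flip: power_Suc of_nat_Suc)
  have "real (Suc s) \<le> 2 ^ k" using assms(2) by (metis Suc_leI of_nat_le_iff of_nat_numeral of_nat_power)
  then have m: "real s / 2 ^ k + h + h \<le> 1" by (simp add: h_def field_simps)
  have e: "real (2 * s + 1) / 2 ^ Suc k = real s / 2 ^ k + h" "real (Suc s) / 2 ^ k = real s / 2 ^ k + h + h"
    by (simp_all add: h_def field_simps)
  have "hoelder_mix \<alpha> n (c * h powr \<alpha>) (\<lambda>xs.
       ((f ((real s / 2 ^ k + h) # xs) - f ((real s / 2 ^ k) # xs)) -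
        (f ((real s / 2 ^ k + h + h) # xs) - f ((real s / 2 ^ k + h) # xs))) / 2)"
    using assms(1) h m unfolding hoelder_mix.simps
    by (intro hoelder_mix_half_diff) (elim conjE allE impE; assumption?; simp)+
  then show ?thesis
    unfolding hp faber_coeff.simps e by (rule back_subst[of "hoelder_mix _ _ _"]) (auto simp: field_simps)
qed

lemma vanishing_faber_coeff:
  assumes "vanishing (Suc n) f" "s < 2 ^ k"
  shows "vanishing n (\<lambda>xs. faber_coeff (k, s) (\<lambda>t. f (t # xs)))"
proof -
  have "real (Suc s) \<le> 2 ^ k" using assms(2) by (metis Suc_leI of_nat_le_iff of_nat_numeral of_nat_power)
  then have "real s / 2 ^ k \<in> {0..1}" "real (2 * s + 1) / 2 ^ Suc k \<in> {0..1}" "real (Suc s) / 2 ^ k \<in> {0..1}"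
    using assms(2) by (auto simp: field_simps)
  then show ?thesis
    using assms(1) unfolding vanishing_def by (auto simp: faber_coeff.simps simp del: of_nat_Suc of_nat_add power_Suc)
qed

fun sparse_index :: "nat \<Rightarrow> nat \<Rightarrow> (nat \<times> nat) list set" where
  "sparse_index 0 m = {[]}"
| "sparse_index (Suc n) m =
     (\<lambda>(k, s, p). (k, s) # p) ` (SIGMA k:{..m}. SIGMA s:{..<2 ^ k}. sparse_index n (m - k))"

fun sparse_coeff :: "(nat \<times> nat) list \<Rightarrow> (real list \<Rightarrow> real) \<Rightarrow> real" where
  "sparse_coeff [] f = f []"
| "sparse_coeff (q # p) f = sparse_coeff p (\<lambda>xs. faber_coeff q (\<lambda>t. f (t # xs)))"

definition sparse_basis :: "(nat \<times> nat) list \<Rightarrow> real list \<Rightarrow> real" where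
  "sparse_basis p xs = prod_list (map2 faber p xs)"

definition sparse_interp :: "nat \<Rightarrow> nat \<Rightarrow> (real list \<Rightarrow> real) \<Rightarrow> real list \<Rightarrow> real" where
  "sparse_interp n m f xs = (\<Sum>p\<in>sparse_index n m. sparse_coeff p f * sparse_basis p xs)"

lemma sparse_basis_Nil [simp]: "sparse_basis [] xs = 1"
  by (simp add: sparse_basis_def)

lemma sparse_basis_Cons [simp]: "sparse_basis (q # p) (t # xs) = faber q t * sparse_basis p xs"
  by (simp add: sparse_basis_def)

lemma finite_sparse_index [simp]: "finite (sparse_index n m)"
  by (induction n arbitrary: m) auto

lemma length_sparse_index: "p \<in> sparse_index n m \<Longrightarrow> length p = n"
  by (induction n arbitrary: m p) auto

lemma sum_sparse_index_Suc:
  "(\<Sum>p\<in>sparse_index (Suc n) m. F p) = (\<Sum>k\<le>m. \<Sum>s<2^k. \<Sum>p\<in>sparse_index n (m - k). F ((k, s) # p))"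
proof -
  have inj: "inj_on (\<lambda>(k, s, p). (k, s) # p) X" for X :: "(nat \<times> nat \<times> (nat \<times> nat) list) set"
    by (auto simp: inj_on_def)
  let ?J = "\<lambda>k. sparse_index n (m - k)"
  have "(\<Sum>k\<le>m. \<Sum>s<2^k. \<Sum>p\<in>?J k. F ((k, s) # p)) = (\<Sum>k\<le>m. \<Sum>(s, p)\<in>{..<2 ^ k} \<times> ?J k. F ((k, s) # p))"
    by (intro sum.cong refl) (simp add: sum.cartesian_product)
  also have "\<dots> = (\<Sum>(k, s, p)\<in>(SIGMA k:{..m}. {..<2 ^ k} \<times> ?J k). F ((k, s) # p))"
    by (subst sum.Sigma) auto
  finally show ?thesis
    unfolding sparse_index.simps sum.reindex[OF inj] by (simp add: case_prod_beta comp_def)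
qed

lemma sparse_interp_Suc:
  "sparse_interp (Suc n) m f (t # xs) =
     (\<Sum>k\<le>m. \<Sum>s<2^k. faber (k, s) t * sparse_interp n (m - k) (\<lambda>xs. faber_coeff (k, s) (\<lambda>t. f (t # xs))) xs)"
  unfolding sparse_interp_def sum_sparse_index_Suc
  by (simp add: sum_distrib_left mult_ac)

text \<open>Every level contributes a factor at most 1. The crude bound serves to weigh the
  multiplication errors, where no decay of the coefficients is exploited.\<close>

lemma sparse_coeff_bound:
  assumes "hoelder_mix \<alpha> n c f" "p \<in> sparse_index n m" "0 \<le> \<alpha>" "0 \<le> c"
  shows "\<bar>sparse_coeff p f\<bar> \<le> c"
  using assms
proof (induction n arbitrary: c f p m)
  case (Suc n)
  then obtain k s p' where p: "p = (k, s) # p'" "s < 2 ^ k" "p' \<in> sparse_index n (m - k)" by auto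
  have "\<bar>sparse_coeff p' (\<lambda>xs. faber_coeff (k, s) (\<lambda>t. f (t # xs)))\<bar> \<le> c * 2 powr (- \<alpha> * real (Suc k))"
    using Suc.prems p by (intro Suc.IH hoelder_mix_faber_coeff) auto
  also have "\<dots> \<le> c * 2 powr 0" using Suc.prems by (intro mult_left_mono powr_mono) auto
  finally show ?case by (simp add: p)
qed auto

lemma sum_atMost_reflect:
  fixes f :: "nat \<Rightarrow> 'a::comm_monoid_add"
  shows "(\<Sum>k\<le>m. f (m - k)) = (\<Sum>k\<le>m. f k)"
  by (rule sum.reindex_bij_witness[of _ "\<lambda>k. m - k" "\<lambda>k. m - k"]) auto

text \<open>The closed form of the recursion \<open>grid_const_Suc\<close>: one remainder for the
  first coordinate, plus those of the other coordinates for every level \<open>k\<close> spent on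
  it.\<close>

fun grid_const :: "nat \<Rightarrow> nat \<Rightarrow> nat" where
  "grid_const 0 m = 0"
| "grid_const (Suc n) m = (m + Suc n) choose n"

lemma grid_const_Suc: "grid_const (Suc n) m = 1 + (\<Sum>k\<le>m. grid_const n (m - k))"
proof -
  have "grid_const (Suc n) m = 1 + (\<Sum>k\<le>m. grid_const n k)"
  proof (cases n)
    case (Suc n')
    show ?thesis unfolding Suc by (induction m) auto
  qed auto
  then show ?thesis by (simp only: sum_atMost_reflect)
qed

text \<open>The coordinates are expanded one after the other.  Expanding the first one up to level \<open>m\<close> leaves
  a univariate interpolation error of size \<open>2 powr (- \<alpha> * (m + 1))\<close>; the coefficients of level \<open>k\<close> are functions
  of the other coordinates with constant \<open>c * 2 powr (- \<alpha> * (k + 1))\<close>, to be expanded up to level \<open>m - k\<close>.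
  All remainders have the same order, and \<^const>\<open>grid_const\<close> counts them.\<close>

theorem sparse_interp_error:
  assumes "hoelder_mix \<alpha> n c f" "vanishing n f" "0 \<le> \<alpha>" "0 \<le> c" "length xs = n" "set xs \<subseteq> {0..1}"
  shows "\<bar>f xs - sparse_interp n m f xs\<bar> \<le> c * 2 powr (- \<alpha> * real (Suc m)) * real (grid_const n m)"
  using assms
proof (induction n arbitrary: m c f xs)
  case 0
  then show ?case by (simp add: sparse_interp_def)
next
  case (Suc n)
  from Suc.prems obtain t ys where xs: "xs = t # ys" "length ys = n" "t \<in> {0..1}" "set ys \<subseteq> {0..1}"
    by (auto simp: length_Suc_conv)
  define g where "g = (\<lambda>t. f (t # ys))"
  let ?G = "\<lambda>k s xs. faber_coeff (k, s) (\<lambda>t. f (t # xs))"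
  let ?e = "c * 2 powr (- \<alpha> * real (Suc m))"
  have "\<bar>g t - (\<Sum>k<Suc m. \<Sum>i<2^k. faber (k, i) t * faber_coeff (k, i) g)\<bar> \<le> ?e"
  proof (rule faber_error)
    show "g 0 = 0" "g 1 = 0" using Suc.prems xs by (auto simp: g_def vanishing_def)
    fix t h :: real assume "0 < h" "0 \<le> t" "t + h \<le> 1"
    then show "\<bar>g (t + h) - g t\<bar> \<le> c * h powr \<alpha>"
      unfolding g_def using Suc.prems xs by (intro hoelder_mix_bound[of _ n _ "\<lambda>ys. f ((t + h) # ys) - f (t # ys)"]) auto
  qed (use Suc.prems xs in auto)
  then have 1: "\<bar>f xs - (\<Sum>k\<le>m. \<Sum>i<2^k. faber (k, i) t * ?G k i ys)\<bar> \<le> ?e"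
    by (simp add: xs g_def lessThan_Suc_atMost)
  have 2: "\<bar>\<Sum>s<2^k. faber (k, s) t * (?G k s ys - sparse_interp n (m - k) (?G k s) ys)\<bar>
     \<le> ?e * real (grid_const n (m - k))" if k: "k \<le> m" for k
  proof -
    obtain s where s: "s < 2 ^ k" "real s \<le> 2 ^ k * t" "2 ^ k * t \<le> real (Suc s)"
      using dyadic_cell[OF xs(3)] .
    have "\<bar>\<Sum>s<2^k. faber (k, s) t * (?G k s ys - sparse_interp n (m - k) (?G k s) ys)\<bar>
       = faber (k, s) t * \<bar>?G k s ys - sparse_interp n (m - k) (?G k s) ys\<bar>"
      unfolding sum_faber_at_cell[OF s] abs_mult using faber_range(1)[of "(k, s)" t] by simp
    also have "\<dots> \<le> 1 * (c * 2 powr (- \<alpha> * real (Suc k)) * 2 powr (- \<alpha> * real (Suc (m - k))) * real (grid_const n (m - k)))"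
      using Suc.prems xs s
      by (intro mult_mono Suc.IH hoelder_mix_faber_coeff vanishing_faber_coeff faber_range) auto
    \<comment> \<open>The steps 1/2^(k+1) and 1/2^(m-k+1) multiply to 1/2^(m+2), independently of
      \<open>k\<close>. One factor \<open>2 powr - \<alpha>\<close> is to spare and is then replaced
      by 1.\<close>
    also have "\<dots> = c * (2 powr (- \<alpha> * real (Suc m)) * 2 powr - \<alpha>) * real (grid_const n (m - k))"
    proof -
      have "- \<alpha> * real (Suc k) + - \<alpha> * real (Suc (m - k)) = - \<alpha> * real (Suc m) + - \<alpha>"
        using k by (simp add: of_nat_diff algebra_simps)
      then have "2 powr (- \<alpha> * real (Suc k)) * 2 powr (- \<alpha> * real (Suc (m - k)))
          = 2 powr (- \<alpha> * real (Suc m)) * 2 powr (- \<alpha>)"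
        by (simp only: powr_add[symmetric])
      then show ?thesis by (simp only: mult_1 mult.assoc)
    qed
    also have "\<dots> \<le> c * (2 powr (- \<alpha> * real (Suc m)) * 2 powr 0) * real (grid_const n (m - k))"
      using Suc.prems by (intro mult_left_mono mult_right_mono powr_mono) auto
    finally show ?thesis by simp
  qed
  have "\<bar>f xs - sparse_interp (Suc n) m f xs\<bar> =
     \<bar>(f xs - (\<Sum>k\<le>m. \<Sum>i<2^k. faber (k, i) t * ?G k i ys)) +
      (\<Sum>k\<le>m. \<Sum>s<2^k. faber (k, s) t * (?G k s ys - sparse_interp n (m - k) (?G k s) ys))\<bar>"
    unfolding xs(1) sparse_interp_Suc by (simp add: right_diff_distrib sum_subtractf)
  also have "\<dots> \<le> ?e + (\<Sum>k\<le>m. ?e * real (grid_const n (m - k)))"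
    by (intro order.trans[OF abs_triangle_ineq] add_mono 1 order.trans[OF sum_abs] sum_mono 2) auto
  also have "\<dots> = ?e * real (grid_const (Suc n) m)"
    unfolding grid_const_Suc by (simp add: distrib_left sum_distrib_left)
  finally show ?case .
qed

section \<open>Size of the grid and number of basis functions active at a point\<close>

lemma card_sparse_index_le: "card (sparse_index (Suc n) m) \<le> 2 ^ Suc m * ((m + n) choose n)"
proof (induction n arbitrary: m)
  case 0
  have "card (sparse_index (Suc 0) m) = (\<Sum>k\<le>m. 2 ^ k)"
    unfolding card_eq_sum sum_sparse_index_Suc by simp
  also have "\<dots> \<le> 2 ^ Suc m" by (induction m) auto
  finally show ?case by simp
next
  case (Suc n)
  have "card (sparse_index (Suc (Suc n)) m) = (\<Sum>k\<le>m. 2 ^ k * card (sparse_index (Suc n) (m - k)))"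
    unfolding card_eq_sum sum_sparse_index_Suc[where n = "Suc n"] by simp
  \<comment> \<open>The powers combine to \<open>2 ^ (m + 1)\<close> for every \<open>k\<close>; the
    binomials then add up along a diagonal of Pascal's triangle.\<close>
  also have "\<dots> \<le> (\<Sum>k\<le>m. 2 ^ k * (2 ^ Suc (m - k) * ((m - k + n) choose n)))"
    by (intro sum_mono mult_left_mono Suc.IH) auto
  also have "\<dots> = (\<Sum>k\<le>m. 2 ^ Suc m * ((m - k + n) choose n))"
    by (intro sum.cong) (auto simp: power_add[symmetric])
  also have "\<dots> = 2 ^ Suc m * (\<Sum>k\<le>m. (k + n) choose n)"
    unfolding sum_distrib_left[symmetric] by (subst sum_atMost_reflect) (rule refl)
  also have "(\<Sum>k\<le>m. (k + n) choose n) = (m + Suc n) choose Suc n"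
    by (induction m) auto
  finally show ?case .
qed

lemma sum_faber_support_le: "(\<Sum>s<2^k. if faber (k, s) t \<noteq> 0 then 1 else 0 :: nat) \<le> 1"
proof (cases "\<exists>s. faber (k, s) t \<noteq> 0")
  case True
  then obtain s where s: "faber (k, s) t \<noteq> 0" by blast
  have "(\<Sum>s<2^k. if faber (k, s) t \<noteq> 0 then 1 else 0 :: nat) = (\<Sum>i<2^k. if i = s then 1 else 0)"
  proof (intro sum.cong refl)
    fix i show "(if faber (k, i) t \<noteq> 0 then 1 else 0 :: nat) = (if i = s then 1 else 0)"
      using s faber_unique[of k i t s] by (cases "i = s") auto
  qed
  then show ?thesis by simp
qed simp

text \<open>In each coordinate a level, at most \<open>m\<close>, determines the only cell whose hat
  can be nonzero at the point. The exponentially many positions thus drop out and only polynomial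
  growth in \<open>m\<close> remains.\<close>

lemma card_sparse_support_le:
  "length xs = n \<Longrightarrow> card {p \<in> sparse_index n m. sparse_basis p xs \<noteq> 0} \<le> Suc m ^ n"
proof (induction n arbitrary: m xs)
  case 0
  have "card {p \<in> sparse_index 0 m. sparse_basis p xs \<noteq> 0} \<le> card {[] :: (nat \<times> nat) list}"
    by (rule card_mono) auto
  then show ?case by simp
next
  case (Suc n)
  then obtain t ys where xs: "xs = t # ys" "length ys = n" by (auto simp: length_Suc_conv)
  have c: "card {p \<in> sparse_index n m. sparse_basis p xs \<noteq> 0} = (\<Sum>p\<in>sparse_index n m. if sparse_basis p xs \<noteq> 0 then 1 else 0)"
    for n m xs by (subst sum.inter_filter[symmetric]) simp_all
  have "card {p \<in> sparse_index (Suc n) m. sparse_basis p xs \<noteq> 0} =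
     (\<Sum>k\<le>m. \<Sum>s<2^k. (if faber (k, s) t \<noteq> 0 then 1 else 0) * card {p \<in> sparse_index n (m - k). sparse_basis p ys \<noteq> 0})"
    unfolding c sum_sparse_index_Suc xs sum_distrib_left
    by (intro sum.cong refl) auto
  also have "\<dots> \<le> (\<Sum>k\<le>m. Suc m ^ n)"
  proof (intro sum_mono)
    fix k
    have "card {p \<in> sparse_index n (m - k). sparse_basis p ys \<noteq> 0} \<le> Suc m ^ n"
      by (rule order.trans[OF Suc.IH[OF xs(2)]]) (auto intro: power_mono)
    then have "(\<Sum>s<2^k. if faber (k, s) t \<noteq> 0 then 1 else 0) *
        card {p \<in> sparse_index n (m - k). sparse_basis p ys \<noteq> 0} \<le> 1 * Suc m ^ n"
      by (intro mult_mono sum_faber_support_le) auto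
    then show "(\<Sum>s<2^k. (if faber (k, s) t \<noteq> 0 then 1 else 0) *
        card {p \<in> sparse_index n (m - k). sparse_basis p ys \<noteq> 0}) \<le> Suc m ^ n"
      by (simp add: sum_distrib_right)
  qed
  finally show ?case by simp
qed

section \<open>The unit ball on the cube\<close>

lemma mixed_diff_empty [simp]: "mixed_diff d h {} f = f"
  by (simp add: mixed_diff_def)

lemma mixed_diff_insert_min:
  assumes "finite u" "\<And>i. i \<in> u \<Longrightarrow> j < i"
  shows "mixed_diff d h (insert j u) f = diff1 d h j (mixed_diff d h u f)"
proof -
  have "sorted_list_of_set (insert j u) = j # sorted_list_of_set u"
    using assms by (subst sorted_list_of_set_insert) (auto simp: insort_is_Cons less_imp_le)
  then show ?thesis by (simp add: mixed_diff_def)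
qed

lemma mixed_diff_step_cong:
  assumes "\<And>i. i \<in> u \<Longrightarrow> h $ i = h' $ i" "finite u"
  shows "mixed_diff d h u = mixed_diff d h' u"
  unfolding mixed_diff_def
  using assms by (intro ext foldr_cong) (auto simp: diff1_def)

lemma U0_ball_mixed_diff_le:
  assumes "f \<in> U0_ball d \<alpha>" "u \<subseteq> {..<d}" "h \<in> carrier_vec d" "\<And>i. i < d \<Longrightarrow> 0 < h $ i" "x \<in> shifted_cube d h u"
  shows "\<bar>mixed_diff d h u f x\<bar> \<le> (\<Prod>i\<in>u. h $ i powr \<alpha>)"
proof -
  have fin: "finite u" using assms(2) finite_subset by blast
  have "holder_seminorm d \<alpha> u f \<le> holder_norm d \<alpha> f"
    unfolding holder_norm_def using assms(2) by (intro Max_ge) auto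
  also have "\<dots> \<le> 1" using assms(1) by (simp add: U0_ball_def)
  finally have 1: "holder_seminorm d \<alpha> u f \<le> 1" .
  define P where "P = (\<Prod>i\<in>u. h $ i powr (- \<alpha>))"
  have "0 < h $ i powr (- \<alpha>)" if "i \<in> u" for i using assms(2) assms(4)[of i] that by auto
  then have pos: "0 < P" unfolding P_def by (rule prod_pos)
  have "ennreal (P * \<bar>mixed_diff d h u f x\<bar>) = ennreal P * ennreal \<bar>mixed_diff d h u f x\<bar>"
    using pos by (simp add: ennreal_mult)
  also have "\<dots> \<le> ennreal P * sup_norm_on (shifted_cube d h u) (mixed_diff d h u f)"
    unfolding sup_norm_on_def using assms(5) by (intro mult_left_mono SUP_upper) auto
  also have "\<dots> \<le> holder_seminorm d \<alpha> u f"
    unfolding holder_seminorm_def P_def using assms(3,4)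
    by (intro SUP_upper2[of h]) auto
  also note 1
  finally have "P * \<bar>mixed_diff d h u f x\<bar> \<le> 1" by simp
  then have "\<bar>mixed_diff d h u f x\<bar> \<le> inverse P" using pos by (simp add: field_simps)
  also have "inverse P = (\<Prod>i\<in>u. h $ i powr \<alpha>)"
    unfolding P_def by (simp add: powr_minus prod_inversef[symmetric])
  finally show ?thesis .
qed

text \<open>The coordinates are listed from the last one to the first, because \<^const>\<open>mixed_diff\<close> applies the
  difference in the smallest coordinate last.\<close>

definition rev_arg :: "(real vec \<Rightarrow> real) \<Rightarrow> real list \<Rightarrow> real" where
  "rev_arg f xs = f (vec_of_list (rev xs))"

text \<open>The coordinates from \<open>n\<close> on have been processed: \<open>ps\<close> holds
  their values, and \<open>u\<close> those that were differenced. Going down in \<open>n\<close>,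
  freezing prepends to \<open>ps\<close>, while differencing also inserts \<open>n\<close> into
  \<open>u\<close> as its new minimum, hence as the outermost difference. At n = 0 the claim is the
  bound on a single mixed difference.\<close>

lemma mixed_diff_hoelder_mix:
  assumes f: "f \<in> U0_ball d \<alpha>"
    and "u \<subseteq> {n..<d}" "h \<in> carrier_vec d" "\<And>i. i < d \<Longrightarrow> 0 < h $ i" "length ps + n = d" "set ps \<subseteq> {0..1}"
      "\<And>i. i \<in> u \<Longrightarrow> ps ! (i - n) + h $ i \<in> {0..1}"
  shows "hoelder_mix \<alpha> n (\<Prod>i\<in>u. h $ i powr \<alpha>) (\<lambda>xs. mixed_diff d h u f (vec_of_list (rev xs @ ps)))"
  using assms(2-)
proof (induction n arbitrary: u h ps)
  case 0
  have "vec_of_list ps \<in> shifted_cube d h u"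
    using 0 by (auto simp: shifted_cube_def cube_def vec_of_list_index intro!: carrier_vecI)
      (metis atLeastAtMost_iff nth_mem subsetD)+
  then show ?case using U0_ball_mixed_diff_le[OF f _ 0(2,3)] 0 by (auto simp: atLeast0LessThan)
next
  case (Suc n)
  have nth: "(t # ps) ! (i - n) = ps ! (i - Suc n)" if "i \<in> u" for i t
  proof -
    have "i \<in> {Suc n..<d}" using that Suc.prems(1) by blast
    then have "i - n = Suc (i - Suc n)" by (auto simp: Suc_diff_Suc)
    then show ?thesis by simp
  qed
  have nd: "n < d" using Suc.prems by simp
  have un: "u \<subseteq> {n..<d}" by (rule order.trans[OF Suc.prems(1)]) auto
  have ext: "hoelder_mix \<alpha> n (\<Prod>i\<in>u. h $ i powr \<alpha>) (\<lambda>xs. mixed_diff d h u f (vec_of_list (rev (t # xs) @ ps)))"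
    if "t \<in> {0..1}" for t
    using Suc.IH[of u h "t # ps"] Suc.prems un that nth by auto
  have step: "hoelder_mix \<alpha> n ((\<Prod>i\<in>u. h $ i powr \<alpha>) * \<eta> powr \<alpha>)
      (\<lambda>xs. mixed_diff d h u f (vec_of_list (rev ((t + \<eta>) # xs) @ ps)) - mixed_diff d h u f (vec_of_list (rev (t # xs) @ ps)))"
    if t: "0 < \<eta>" "0 \<le> t" "t + \<eta> \<le> 1" for t \<eta>
  proof -
    \<comment> \<open>The seminorm quantifies over full step vectors, so the new step is written
      into entry \<open>n\<close>; the entries in \<open>u\<close> are kept.\<close>
    define h' where "h' = vec d (\<lambda>i. if i = n then \<eta> else h $ i)"
    have h': "h' $ n = \<eta>" "\<And>i. i \<in> u \<Longrightarrow> h' $ i = h $ i" "h' \<in> carrier_vec d" "\<And>i. i < d \<Longrightarrow> 0 < h' $ i"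
      using nd Suc.prems t by (auto simp: h'_def)
    have fin: "finite u" using Suc.prems(1) finite_subset by blast
    have nu: "n \<notin> u" using Suc.prems(1) by auto
    have "hoelder_mix \<alpha> n (\<Prod>i\<in>insert n u. h' $ i powr \<alpha>) (\<lambda>xs. mixed_diff d h' (insert n u) f (vec_of_list (rev xs @ t # ps)))"
    proof (rule Suc.IH)
      fix i assume "i \<in> insert n u"
      then show "(t # ps) ! (i - n) + h' $ i \<in> {0..1}"
        using Suc.prems(6) nth h' t by auto
    qed (use Suc.prems un nd h' t in auto)
    also have "(\<Prod>i\<in>insert n u. h' $ i powr \<alpha>) = (\<Prod>i\<in>u. h $ i powr \<alpha>) * \<eta> powr \<alpha>"
      using fin nu h' by (simp add: mult.commute)
    finally have *: "hoelder_mix \<alpha> n ((\<Prod>i\<in>u. h $ i powr \<alpha>) * \<eta> powr \<alpha>)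
       (\<lambda>xs. mixed_diff d h' (insert n u) f (vec_of_list (rev xs @ t # ps)))" .
    have m: "mixed_diff d h' u = mixed_diff d h u" by (rule mixed_diff_step_cong) (use h' fin in auto)
    have mi: "mixed_diff d h' (insert n u) f = diff1 d h' n (mixed_diff d h u f)"
      unfolding m[symmetric] using Suc.prems(1) fin by (intro mixed_diff_insert_min) (auto simp: Suc_le_eq)
    have v: "vec_of_list (rev xs @ t # ps) + h' $ n \<cdot>\<^sub>v unit_vec d n = vec_of_list (rev xs @ (t + \<eta>) # ps)"
      if "length xs = n" for xs
      by (rule eq_vecI) (use that Suc.prems(4) h'(1) in \<open>auto simp: vec_of_list_index nth_append nth_Cons split: nat.splits\<close>)
    show ?thesis
      by (rule hoelder_mix_cong[THEN iffD1, OF _ *]) (simp add: mi diff1_def v)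
  qed
  show ?case
    unfolding hoelder_mix.simps using ext step by auto
qed

lemma U0_ball_hoelder_mix: "f \<in> U0_ball d \<alpha> \<Longrightarrow> hoelder_mix \<alpha> d 1 (rev_arg f)"
  using mixed_diff_hoelder_mix[of f d \<alpha> "{}" d "vec d (\<lambda>_. 1)" "[]"] by (simp add: rev_arg_def[abs_def])

text \<open>Through an interior point of the cube, a short segment in direction \<open>i\<close>
  would stay inside it. The line \<gamma> is continuous into the product topology, so the segment
  can be found in the reals.\<close>

lemma boundary_in_frontier:
  assumes "x \<in> cube d" "i < d" "x $ i = 0 \<or> x $ i = 1"
  shows "x \<in> vec_topology d frontier_of cube d"
proof -
  let ?X = "vec_topology d" and ?r = "\<lambda>x. restrict (\<lambda>i. x $ i) {..<d}"
  let ?P = "product_topology (\<lambda>_. euclideanreal) {..<d}"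
  have top: "topspace ?X = carrier_vec d"
    by (auto simp: vec_topology_def topspace_pullback_topology)
  have "x \<in> ?X closure_of cube d"
    using assms(1) closure_of_subset[of "cube d" ?X] top by (auto simp: cube_def)
  moreover have "x \<notin> ?X interior_of cube d"
  proof
    assume "x \<in> ?X interior_of cube d"
    then obtain T where T: "openin ?X T" "x \<in> T" "T \<subseteq> cube d" by (auto simp: interior_of_def)
    then obtain U where U: "openin ?P U" "T = ?r -` U \<inter> carrier_vec d"
      unfolding vec_topology_def openin_pullback_topology by blast
    define \<gamma> where "\<gamma> t = restrict (\<lambda>j. if j = i then t else x $ j) {..<d}" for t
    have "continuous_map euclideanreal ?P \<gamma>"
      unfolding continuous_map_componentwise by (auto simp: \<gamma>_def extensional_def)
    then have "openin euclideanreal {t \<in> topspace euclideanreal. \<gamma> t \<in> U}"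
      using U(1) by (rule openin_continuous_map_preimage)
    then have op: "open {t. \<gamma> t \<in> U}" by simp
    have g: "\<gamma> (x $ i) = ?r x" by (auto simp: \<gamma>_def restrict_def)
    have "x $ i \<in> {t. \<gamma> t \<in> U}" using T(2) U(2) g by auto
    then obtain e where e: "e > 0" "ball (x $ i) e \<subseteq> {t. \<gamma> t \<in> U}" using op openE by blast
    \<comment> \<open>A point of the segment on the outer side of the face.\<close>
    define t where "t = (if x $ i = 0 then - (e / 2) else 1 + e / 2)"
    have "t \<in> ball (x $ i) e" using e(1) assms(3) by (auto simp: t_def dist_real_def)
    then have "\<gamma> t \<in> U" using e(2) by auto
    define y where "y = vec d (\<lambda>j. if j = i then t else x $ j)"
    have "?r y = \<gamma> t" by (auto simp: y_def \<gamma>_def restrict_def)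
    then have "y \<in> T" using \<open>\<gamma> t \<in> U\<close> U(2) by (auto simp: y_def)
    then have "y $ i \<in> {0..1}" using T(3) assms(2) by (auto simp: cube_def)
    then show False using e(1) assms(2) by (auto simp: y_def t_def split: if_splits)
  qed
  ultimately show ?thesis by (simp add: frontier_of_def)
qed

lemma U0_ball_vanishing:
  assumes "f \<in> U0_ball d \<alpha>"
  shows "vanishing d (rev_arg f)"
  unfolding vanishing_def rev_arg_def
proof (intro allI impI)
  fix xs :: "real list" assume xs: "length xs = d" "set xs \<subseteq> {0..1}" "0 \<in> set xs \<or> 1 \<in> set xs"
  let ?x = "vec_of_list (rev xs)"
  from xs(3) have "0 \<in> set (rev xs) \<or> 1 \<in> set (rev xs)" by simp
  then obtain i where i: "i < length (rev xs)" "rev xs ! i = 0 \<or> rev xs ! i = 1" unfolding in_set_conv_nth by blast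
  have "rev xs ! j \<in> {0..1}" if "j < d" for j
    using xs(1,2) that nth_mem[of j "rev xs"] by (auto simp del: nth_mem)
  then have "?x \<in> cube d" using xs(1) by (auto simp: cube_def vec_of_list_index intro!: carrier_vecI)
  then have "?x \<in> vec_topology d frontier_of cube d"
    by (rule boundary_in_frontier[where i = i]) (use i xs(1) in \<open>auto simp: vec_of_list_index\<close>)
  then show "f ?x = 0" using assms by (auto simp: U0_ball_def C0_cube_def)
qed

section \<open>Networks as sequences of function sets\<close>

text \<open>The fan-in 5 is what the accumulator of the multiplication network needs. Together with
  the bias it yields at most 6 nonzero parameters per neuron, so counting neurons is counting
  size.\<close>

definition neuron :: "(real vec \<Rightarrow> real) set \<Rightarrow> (real vec \<Rightarrow> real) \<Rightarrow> bool" where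
  "neuron T f \<longleftrightarrow> (\<exists>b ws. length ws \<le> 5 \<and> snd ` set ws \<subseteq> T \<and>
     f = (\<lambda>x. relu (b + (\<Sum>(w, g)\<leftarrow>ws. w * g x))))"

text \<open>The numbers are a depth and an upper bound on the number of neurons; every layer, including the last
  one, is followed by an activation.  Neurons are identified with the functions that they compute.\<close>

inductive computes :: "nat \<Rightarrow> nat \<Rightarrow> nat \<Rightarrow> (real vec \<Rightarrow> real) set \<Rightarrow> bool" for d where
  input: "computes d 0 M ((\<lambda>i x. x $ i) ` {..<d})"
| layer: "computes d L M T \<Longrightarrow> finite T' \<Longrightarrow> T' \<noteq> {} \<Longrightarrow> card T' \<le> k \<Longrightarrow> \<forall>f\<in>T'. neuron T f \<Longrightarrow>
     computes d (Suc L) (M + k) T'"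

lemma neuron_mono: "neuron T f \<Longrightarrow> T \<subseteq> T' \<Longrightarrow> neuron T' f"
  unfolding neuron_def by blast

lemma neuronI:
  "length ws \<le> 5 \<Longrightarrow> snd ` set ws \<subseteq> T \<Longrightarrow> (\<And>x. f x = relu (b + (\<Sum>(w, g)\<leftarrow>ws. w * g x))) \<Longrightarrow> neuron T f"
  unfolding neuron_def by blast

text \<open>Two networks of equal depth run in parallel on the same input; neurons computing equal
  functions are merged, which can only lower the count.\<close>

lemma computes_Un:
  "computes d L M T \<Longrightarrow> computes d L M' T' \<Longrightarrow> computes d L (M + M') (T \<union> T')"
proof (induction arbitrary: M' T' rule: computes.induct)
  case (input M)
  then show ?case by cases (auto intro: computes.input)
next
  case (layer L M T T1 k)
  from layer.prems obtain M0 T0 k0 where 0: "M' = M0 + k0" "computes d L M0 T0" "finite T'" "T' \<noteq> {}"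
      "card T' \<le> k0" "\<forall>f\<in>T'. neuron T0 f"
    by cases auto
  have "computes d (Suc L) ((M + M0) + (k + k0)) (T1 \<union> T')"
  proof (rule computes.layer[OF layer.IH[OF 0(2)]])
    show "card (T1 \<union> T') \<le> k + k0" using card_Un_le[of T1 T'] layer.hyps 0 by linarith
  qed (use layer.hyps 0 in \<open>auto intro: neuron_mono\<close>)
  then show ?case by (simp add: 0(1) add_ac)
qed

lemma computes_UN:
  assumes "finite I" "I \<noteq> {}" "\<And>i. i \<in> I \<Longrightarrow> computes d L M (T i)"
  shows "computes d L (card I * M) (\<Union>i\<in>I. T i)"
  using assms
proof (induction I rule: finite_ne_induct)
  case (insert i I)
  then show ?case using computes_Un[of d L M "T i" "card I * M" "\<Union>i\<in>I. T i"] by auto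
qed auto

section \<open>From sets of functions to matrices\<close>

definition layer_size :: "real mat \<times> real vec \<Rightarrow> nat" where
  "layer_size l = card {(i, j). i < dim_row (fst l) \<and> j < dim_col (fst l) \<and> fst l $$ (i, j) \<noteq> 0} +
     card {i. i < dim_vec (snd l) \<and> snd l $ i \<noteq> 0}"

lemma net_size_Nil [simp]: "net_size [] = 0"
  by (simp add: net_size_def net_depth_def)

lemma net_size_snoc [simp]: "net_size (\<Phi> @ [l]) = net_size \<Phi> + layer_size l"
  by (simp add: net_size_def net_depth_def layer_size_def nth_append)

text \<open>\<open>net_dims\<close> reads the input dimension off the first layer and says nothing
  useful about the empty list, from which networks are built up here. The list of dimensions is
  therefore carried explicitly.\<close>

definition dims_ok :: "nat list \<Rightarrow> network \<Rightarrow> bool" where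
  "dims_ok ns \<Phi> \<longleftrightarrow> length ns = Suc (length \<Phi>) \<and>
     (\<forall>l<length \<Phi>. fst (\<Phi> ! l) \<in> carrier_mat (ns ! Suc l) (ns ! l) \<and>
        snd (\<Phi> ! l) \<in> carrier_vec (ns ! Suc l) \<and> 1 \<le> ns ! Suc l)"

lemma dims_ok_snoc:
  assumes "dims_ok ns \<Phi>" "W \<in> carrier_mat n (last ns)" "b \<in> carrier_vec n" "1 \<le> n"
  shows "dims_ok (ns @ [n]) (\<Phi> @ [(W, b)])"
proof -
  have "last ns = ns ! length \<Phi>" using assms(1) by (subst last_conv_nth) (auto simp: dims_ok_def)
  then show ?thesis
    using assms unfolding dims_ok_def
    by (auto simp: nth_append less_Suc_eq)
qed

lemma net_dims_eq:
  assumes "dims_ok ns \<Phi>" "\<Phi> \<noteq> []"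
  shows "net_dims \<Phi> = ns"
proof (rule nth_equalityI)
  show "length (net_dims \<Phi>) = length ns" using assms by (simp add: net_dims_def dims_ok_def)
  fix i assume "i < length (net_dims \<Phi>)"
  then have i: "i \<le> length \<Phi>" by (simp add: net_dims_def)
  show "net_dims \<Phi> ! i = ns ! i"
  proof (cases i)
    case 0
    then show ?thesis using assms by (auto simp: net_dims_def dims_ok_def hd_conv_nth)
  next
    case (Suc j)
    then have "fst (\<Phi> ! j) \<in> carrier_mat (ns ! Suc j) (ns ! j)" using assms i by (simp add: dims_ok_def)
    then show ?thesis using Suc i by (auto simp: net_dims_def case_prod_beta)
  qed
qed

lemma is_network_dims_ok:
  assumes "dims_ok ns \<Phi>" "2 \<le> length \<Phi>" "hd ns = d"
  shows "is_network d \<Phi>"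
proof -
  have "net_dims \<Phi> = ns" using assms by (intro net_dims_eq) auto
  moreover have "ns ! 0 = d" using assms by (cases ns) (auto simp: dims_ok_def)
  ultimately show ?thesis using assms by (auto simp: is_network_def net_depth_def dims_ok_def)
qed

text \<open>Layers are appended at the end, whereas \<open>relu_output\<close> recurses from the
  front and treats the last layer differently. This version activates every layer.\<close>

definition hidden_output :: "network \<Rightarrow> real vec \<Rightarrow> real vec" where
  "hidden_output \<Phi> x = fold (\<lambda>(W, b) z. map_vec relu (W *\<^sub>v z + b)) \<Phi> x"

lemma hidden_output_snoc [simp]:
  "hidden_output (\<Phi> @ [(W, b)]) x = map_vec relu (W *\<^sub>v hidden_output \<Phi> x + b)"
  by (simp add: hidden_output_def)

lemma relu_output_snoc: "relu_output (\<Phi> @ [(W, b)]) x = W *\<^sub>v hidden_output \<Phi> x + b"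
proof (induction \<Phi> arbitrary: x)
  case (Cons l \<Phi>)
  obtain W' b' where l: "l = (W', b')" by (cases l)
  obtain l' \<Phi>' where "\<Phi> @ [(W, b)] = l' # \<Phi>'" by (cases "\<Phi> @ [(W, b)]") auto
  then have "relu_output ((l # \<Phi>) @ [(W, b)]) x = relu_output (\<Phi> @ [(W, b)]) (map_vec relu (W' *\<^sub>v x + b'))"
    by (simp add: l)
  then show ?case by (simp add: Cons.IH hidden_output_def l)
qed (simp add: hidden_output_def)

definition pattern :: "network \<Rightarrow> network" where
  "pattern \<Phi> = map (\<lambda>(W, b). (map_mat (\<lambda>t. if t = 0 then 0 else 1) W, map_vec (\<lambda>t. if t = 0 then 0 else 1) b)) \<Phi>"

lemma dims_ok_pattern: "dims_ok ns \<Phi> \<Longrightarrow> dims_ok ns (pattern \<Phi>)"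
  by (auto simp: dims_ok_def pattern_def case_prod_beta)

lemma net_size_pattern: "net_size (pattern \<Phi>) = net_size \<Phi>"
proof -
  have "layer_size (pattern \<Phi> ! l) = layer_size (\<Phi> ! l)" if "l < length \<Phi>" for l
    using that unfolding layer_size_def pattern_def
    by (intro arg_cong2[of _ _ _ _ "(+)"] arg_cong[of _ _ card] Collect_cong) (auto simp: case_prod_beta split: if_splits)
  then show ?thesis
    unfolding net_size_def net_depth_def by (simp add: pattern_def layer_size_def)
qed

lemma pattern_binary:
  assumes "l < length \<Phi>"
  shows "elements_mat (fst (pattern \<Phi> ! l)) \<subseteq> {0, 1}" "set\<^sub>v (snd (pattern \<Phi> ! l)) \<subseteq> {0, 1}"
  using assms by (auto simp: pattern_def case_prod_beta elements_mat_def vec_set_def)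

text \<open>Row \<open>i\<close> of the matrix is nonzero only at the positions of the at most 5
  inputs of neuron \<open>i\<close>.\<close>

lemma neuron_layer:
  assumes "\<forall>f\<in>set ts'. neuron (set ts) f"
  shows "\<exists>W b. W \<in> carrier_mat (length ts') (length ts) \<and> b \<in> carrier_vec (length ts') \<and>
     layer_size (W, b) \<le> 6 * length ts' \<and>
     (\<forall>x. map_vec relu (W *\<^sub>v vec_of_list (map (\<lambda>g. g x) ts) + b) = vec_of_list (map (\<lambda>g. g x) ts'))"
proof -
  let ?n = "length ts'" and ?k = "length ts"
  have "\<forall>i<?n. \<exists>b ws. length ws \<le> 5 \<and> snd ` set ws \<subseteq> set ts \<and>
      ts' ! i = (\<lambda>x. relu (b + (\<Sum>(w, g)\<leftarrow>ws. w * g x)))"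
    using assms by (auto simp: neuron_def)
  then obtain b ws where bw: "\<And>i. i < ?n \<Longrightarrow> length (ws i) \<le> 5" "\<And>i. i < ?n \<Longrightarrow> snd ` set (ws i) \<subseteq> set ts"
      "\<And>i. i < ?n \<Longrightarrow> ts' ! i = (\<lambda>x. relu (b i + (\<Sum>(w, g)\<leftarrow>ws i. w * g x)))"
    by metis
  define idx where "idx g = (SOME j. j < ?k \<and> ts ! j = g)" for g
  have idx: "idx g < ?k \<and> ts ! idx g = g" if "g \<in> set ts" for g
    unfolding idx_def by (rule someI_ex) (use that in \<open>auto simp: in_set_conv_nth\<close>)
  \<comment> \<open>A sum, because the same input may be listed several times with different
    weights.\<close>
  define W where "W = mat ?n ?k (\<lambda>(i, j). \<Sum>(w, g)\<leftarrow>ws i. if idx g = j then w else 0)"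
  define v where "v = vec ?n b"
  have row: "(\<Sum>j<?k. (\<Sum>(w, g)\<leftarrow>us. if idx g = j then w else 0) * (ts ! j) x) = (\<Sum>(w, g)\<leftarrow>us. w * g x)"
    if "snd ` set us \<subseteq> set ts" for us x
    using that
  proof (induction us)
    case (Cons u us)
    obtain w g where u: "u = (w, g)" by (cases u)
    have g: "idx g < ?k" "ts ! idx g = g" using idx[of g] Cons.prems u by auto
    have "(\<Sum>j<?k. (if idx g = j then w else 0) * (ts ! j) x) = (\<Sum>j<?k. if idx g = j then w * (ts ! j) x else 0)"
      by (intro sum.cong) auto
    also have "\<dots> = w * g x" using g by (simp add: sum.delta)
    finally show ?case using Cons u by (simp add: distrib_right sum.distrib)
  qed simp
  have "map_vec relu (W *\<^sub>v vec_of_list (map (\<lambda>g. g x) ts) + v) = vec_of_list (map (\<lambda>g. g x) ts')" for x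
  proof (rule eq_vecI)
    fix i assume "i < dim_vec (vec_of_list (map (\<lambda>g. g x) ts'))"
    then have i: "i < ?n" by simp
    have "(W *\<^sub>v vec_of_list (map (\<lambda>g. g x) ts)) $ i =
        (\<Sum>j<?k. (\<Sum>(w, g)\<leftarrow>ws i. if idx g = j then w else 0) * (ts ! j) x)"
      using i by (auto simp: W_def scalar_prod_def vec_of_list_index lessThan_atLeast0 intro!: sum.cong)
    then show "map_vec relu (W *\<^sub>v vec_of_list (map (\<lambda>g. g x) ts) + v) $ i = vec_of_list (map (\<lambda>g. g x) ts') $ i"
      using i bw(2,3) by (simp add: row W_def v_def vec_of_list_index add.commute)
  qed (auto simp: W_def v_def)
  moreover have "layer_size (W, v) \<le> 6 * ?n"
  proof -
    have fin: "finite (SIGMA i:{..<?n}. (idx \<circ> snd) ` set (ws i))" by auto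
    have "{(i, j). i < ?n \<and> j < ?k \<and> W $$ (i, j) \<noteq> 0} \<subseteq> (SIGMA i:{..<?n}. (idx \<circ> snd) ` set (ws i))"
    proof clarsimp
      fix i j assume i: "i < ?n" "j < ?k" and nz: "W $$ (i, j) \<noteq> 0"
      show "j \<in> (\<lambda>x. idx (snd x)) ` set (ws i)"
      proof (rule ccontr)
        assume "j \<notin> (\<lambda>x. idx (snd x)) ` set (ws i)"
        then have "map (\<lambda>(w, g). if idx g = j then w else 0) (ws i) = map (\<lambda>_. 0) (ws i)" by (force intro: map_cong)
        then show False using i nz by (simp add: W_def map_replicate_const sum_list_replicate)
      qed
    qed
    then have "card {(i, j). i < ?n \<and> j < ?k \<and> W $$ (i, j) \<noteq> 0} \<le> card (SIGMA i:{..<?n}. (idx \<circ> snd) ` set (ws i))"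
      by (rule card_mono[OF fin])
    also have "\<dots> = (\<Sum>i<?n. card ((idx \<circ> snd) ` set (ws i)))" by (subst card_SigmaI) auto
    also have "\<dots> \<le> (\<Sum>i<?n. 5)"
      by (intro sum_mono order.trans[OF card_image_le] order.trans[OF card_length] bw(1)) auto
    finally have "card {(i, j). i < ?n \<and> j < ?k \<and> W $$ (i, j) \<noteq> 0} \<le> 5 * ?n" by simp
    moreover have "card {i. i < ?n \<and> v $ i \<noteq> 0} \<le> card {..<?n}" by (rule card_mono) auto
    ultimately show ?thesis by (simp add: layer_size_def W_def v_def)
  qed
  ultimately show ?thesis by (intro exI[of _ W] exI[of _ v]) (auto simp: W_def v_def)
qed

lemma computes_hidden:
  assumes "computes d L M T"
  shows "\<exists>ts ns \<Phi>. distinct ts \<and> set ts = T \<and> length \<Phi> = L \<and> dims_ok ns \<Phi> \<and> hd ns = d \<and> last ns = length ts \<and>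
     net_size \<Phi> \<le> 6 * M \<and> (\<forall>x\<in>carrier_vec d. hidden_output \<Phi> x = vec_of_list (map (\<lambda>g. g x) ts))"
  using assms
proof (induction rule: computes.induct)
  case (input M)
  let ?ts = "map (\<lambda>i x. x $ i) [0..<d] :: (real vec \<Rightarrow> real) list"
  have "inj_on (\<lambda>i x. x $ i :: real) {0..<d}"
  proof (rule inj_onI)
    fix i j assume "i \<in> {0..<d}" "j \<in> {0..<d}" and e: "(\<lambda>x. x $ i :: real) = (\<lambda>x. x $ j)"
    then show "i = j" using fun_cong[OF e, of "unit_vec d i"] by (auto split: if_splits)
  qed
  then have "distinct ?ts" by (simp add: distinct_map)
  moreover have "dims_ok [d] []" by (simp add: dims_ok_def)
  moreover have "\<forall>x\<in>carrier_vec d. hidden_output [] x = vec_of_list (map (\<lambda>g. g x) ?ts)"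
    by (auto simp: hidden_output_def vec_of_list_index comp_def intro!: eq_vecI)
  ultimately show ?case
    by (intro exI[of _ ?ts] exI[of _ "[d]"] exI[of _ "[] :: network"]) (auto simp: atLeast0LessThan)
next
  case (layer L M T T' k)
  then obtain ts ns \<Phi> where IH: "set ts = T" "length \<Phi> = L" "dims_ok ns \<Phi>" "hd ns = d" "last ns = length ts"
     "net_size \<Phi> \<le> 6 * M" "\<And>x. x \<in> carrier_vec d \<Longrightarrow> hidden_output \<Phi> x = vec_of_list (map (\<lambda>g. g x) ts)"
    by blast
  obtain ts' where ts': "set ts' = T'" "distinct ts'" using finite_distinct_list[OF layer.hyps(2)] by blast
  then have n: "1 \<le> length ts'" "length ts' \<le> k" using layer.hyps(3,4) by (auto simp: distinct_card Suc_le_eq)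
  from neuron_layer[of ts' ts] obtain W b where Wb: "W \<in> carrier_mat (length ts') (length ts)"
     "b \<in> carrier_vec (length ts')" "layer_size (W, b) \<le> 6 * length ts'"
     "\<And>x. map_vec relu (W *\<^sub>v vec_of_list (map (\<lambda>g. g x) ts) + b) = vec_of_list (map (\<lambda>g. g x) ts')"
    using layer.hyps(5) ts' IH(1) by metis
  have "dims_ok (ns @ [length ts']) (\<Phi> @ [(W, b)])"
    using IH Wb n by (intro dims_ok_snoc) auto
  moreover have "ns \<noteq> []" using IH(3) by (auto simp: dims_ok_def)
  ultimately show ?case
    using IH Wb n ts'
    by (intro exI[of _ ts'] exI[of _ "ns @ [length ts']"] exI[of _ "\<Phi> @ [(W, b)]"]) auto
qed

text \<open>The hidden layers are the same for all \<open>c\<close>, and only the output row varies.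
  The architecture is the nonzero pattern for the output row of ones, so it admits every choice of
  \<open>c\<close>; this row accounts for the summand \<open>card T\<close>.\<close>

theorem computes_realization:
  assumes "computes d L M T" "2 \<le> L"
  shows "\<exists>A. is_architecture d A \<and> is_deep A \<and> last (net_dims A) = 1 \<and> net_size A \<le> 6 * M + card T \<and>
     net_depth A = Suc L \<and>
     (\<forall>c. \<exists>\<Phi>. is_network d \<Phi> \<and> is_deep \<Phi> \<and> has_architecture \<Phi> A \<and>
        (\<forall>x\<in>carrier_vec d. relu_output \<Phi> x $ 0 = (\<Sum>f\<in>T. c f * f x)))"
proof -
  obtain ts ns \<Phi> where H: "distinct ts" "set ts = T" "length \<Phi> = L" "dims_ok ns \<Phi>" "hd ns = d" "last ns = length ts"
     "net_size \<Phi> \<le> 6 * M" "\<And>x. x \<in> carrier_vec d \<Longrightarrow> hidden_output \<Phi> x = vec_of_list (map (\<lambda>g. g x) ts)"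
    using computes_hidden[OF assms(1)] by blast
  have n: "length ts = card T" using H by (metis distinct_card)
  have ns: "ns \<noteq> []" using H by (auto simp: dims_ok_def)
  define N where "N c = \<Phi> @ [(mat 1 (length ts) (\<lambda>(i, j). c (ts ! j)), 0\<^sub>v 1)]" for c :: "(real vec \<Rightarrow> real) \<Rightarrow> real"
  have len: "length (N c) = Suc L" for c by (simp add: N_def H)
  have dims: "dims_ok (ns @ [1]) (N c)" for c
    unfolding N_def by (rule dims_ok_snoc) (use H in auto)
  have net: "is_network d (N c)" for c
    by (rule is_network_dims_ok[OF dims]) (use assms H ns len in auto)
  let ?A = "pattern (N (\<lambda>_. 1))"
  have lenA: "length ?A = Suc L" by (simp add: pattern_def len)
  have dimsA: "dims_ok (ns @ [1]) ?A" by (rule dims_ok_pattern[OF dims])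
  have net_dims: "net_dims (N c) = ns @ [1]" for c
    by (rule net_dims_eq[OF dims]) (use len[of c] in auto)
  have net_dimsA: "net_dims ?A = ns @ [1]"
    by (rule net_dims_eq[OF dimsA]) (use lenA in auto)
  have "is_network d ?A" by (rule is_network_dims_ok[OF dimsA]) (use assms H ns lenA in auto)
  then have arch: "is_architecture d ?A"
    using pattern_binary[of _ "N (\<lambda>_. 1)"] by (auto simp: is_architecture_def net_depth_def lenA len)
  have size: "net_size ?A \<le> 6 * M + card T"
  proof -
    let ?W = "mat 1 (length ts) (\<lambda>(i, j). 1) :: real mat"
    have "card {(i, j). i < 1 \<and> j < length ts \<and> ?W $$ (i, j) \<noteq> 0} \<le> card ({0::nat} \<times> {..<length ts})"
      by (rule card_mono) auto
    then have "layer_size (?W, 0\<^sub>v 1) \<le> card ({0::nat} \<times> {..<length ts})"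
      by (simp add: layer_size_def cong: conj_cong)
    then show ?thesis unfolding net_size_pattern using H(7) n by (simp add: N_def)
  qed
  have has_arch: "has_architecture (N c) ?A" for c
    unfolding has_architecture_def net_depth_def lenA net_dims net_dimsA
    by (auto simp: pattern_def N_def case_prod_beta nth_append H(3) split: if_splits)
  have out: "relu_output (N c) x $ 0 = (\<Sum>f\<in>T. c f * f x)" if "x \<in> carrier_vec d" for c x
  proof -
    have "relu_output (N c) x $ 0 = (\<Sum>j<length ts. c (ts ! j) * (ts ! j) x)"
      unfolding N_def relu_output_snoc H(8)[OF that]
      by (simp add: scalar_prod_def vec_of_list_index lessThan_atLeast0)
    also have "\<dots> = (\<Sum>f\<leftarrow>ts. c f * f x)" by (simp add: sum_list_sum_nth lessThan_atLeast0)
    also have "\<dots> = (\<Sum>f\<in>T. c f * f x)" using H by (simp add: sum_list_distinct_conv_sum_set)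
    finally show ?thesis .
  qed
  have deep: "is_deep (N c)" "is_deep ?A" for c
    using len lenA assms(2) by (simp_all add: is_deep_def net_depth_def)
  show ?thesis
  proof (rule exI[of _ ?A], intro conjI allI)
    fix c
    show "\<exists>\<Phi>. is_network d \<Phi> \<and> is_deep \<Phi> \<and> has_architecture \<Phi> ?A \<and>
        (\<forall>x\<in>carrier_vec d. relu_output \<Phi> x $ 0 = (\<Sum>f\<in>T. c f * f x))"
      using net deep has_arch out by (intro exI[of _ "N c"]) blast
  qed (use arch size deep net_dimsA lenA in \<open>auto simp: net_depth_def\<close>)
qed

section \<open>Approximate multiplication\<close>

lemma relu_nonneg: "0 \<le> relu t"
  by (simp add: relu_def)

definition tent :: "real \<Rightarrow> real" where
  "tent t = 2 * t - 4 * relu (t - 1/2)"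

lemma tent_range: "0 \<le> t \<Longrightarrow> t \<le> 1 \<Longrightarrow> 0 \<le> tent t \<and> tent t \<le> 1"
  by (auto simp: tent_def relu_def max_def)

lemma funpow_tent_range: "0 \<le> t \<Longrightarrow> t \<le> 1 \<Longrightarrow> 0 \<le> (tent ^^ j) t \<and> (tent ^^ j) t \<le> 1"
  by (induction j) (auto intro: tent_range[THEN conjunct1] tent_range[THEN conjunct2])

text \<open>The piecewise linear interpolant of t - t^2 at the multiples of 1/2^r: the iterated tent
  maps are the sums of all hats of one level, and the parabola has constant coefficients on each
  level.\<close>

definition sawtooth :: "nat \<Rightarrow> real \<Rightarrow> real" where
  "sawtooth r t = (\<Sum>j<r. (tent ^^ Suc j) t / 4 ^ Suc j)"

lemma sawtooth_Suc_tent: "sawtooth (Suc r) t = (tent t + sawtooth r (tent t)) / 4"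
proof -
  have "sawtooth (Suc r) t = tent t / 4 + (\<Sum>j<r. (tent ^^ Suc (Suc j)) t / 4 ^ Suc (Suc j))"
    unfolding sawtooth_def by (subst sum.lessThan_Suc_shift) simp
  also have "(\<Sum>j<r. (tent ^^ Suc (Suc j)) t / 4 ^ Suc (Suc j)) = sawtooth r (tent t) / 4"
    unfolding sawtooth_def sum_divide_distrib by (intro sum.cong) (auto simp: funpow_swap1)
  finally show ?thesis by simp
qed

text \<open>The parabola \<open>t - t\<^sup>2\<close> satisfies the same recursion exactly.\<close>

lemma sawtooth_error:
  "0 \<le> t \<Longrightarrow> t \<le> 1 \<Longrightarrow> 0 \<le> t - t\<^sup>2 - sawtooth r t \<and> t - t\<^sup>2 - sawtooth r t \<le> 1 / 4 ^ Suc r"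
proof (induction r arbitrary: t)
  case 0
  have "0 \<le> t * (1 - t)" using 0 by simp
  moreover have "0 \<le> (t - 1/2)\<^sup>2" by simp
  ultimately show ?case by (simp add: sawtooth_def power2_eq_square algebra_simps)
next
  case (Suc r)
  have e: "t - t\<^sup>2 = (tent t + (tent t - (tent t)\<^sup>2)) / 4"
    by (simp add: tent_def relu_def max_def power2_eq_square field_simps)
  then have "t - t\<^sup>2 - sawtooth (Suc r) t = (tent t - (tent t)\<^sup>2 - sawtooth r (tent t)) / 4"
    unfolding sawtooth_Suc_tent e by (simp add: diff_divide_distrib add_divide_distrib)
  then show ?case using Suc.IH[of "tent t"] tent_range[OF Suc.prems] by simp
qed

lemma sawtooth_range:
  assumes "0 \<le> t" "t \<le> 1"
  shows "0 \<le> sawtooth r t" "sawtooth r t \<le> 1"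
proof -
  show "0 \<le> sawtooth r t"
    unfolding sawtooth_def using funpow_tent_range[OF assms] by (intro sum_nonneg divide_nonneg_pos) (auto simp del: funpow.simps)
  show "sawtooth r t \<le> 1" using sawtooth_error[OF assms, of r] assms zero_le_power2[of t] by linarith
qed

definition raw_prod :: "nat \<Rightarrow> real \<Rightarrow> real \<Rightarrow> real" where
  "raw_prod r a b = min a b - sawtooth r ((a + b) / 2) + sawtooth r (\<bar>a - b\<bar> / 2)"

definition approx_prod :: "nat \<Rightarrow> real \<Rightarrow> real \<Rightarrow> real" where
  "approx_prod r a b = max 0 (min 1 (raw_prod r a b))"

lemma approx_prod_range: "0 \<le> approx_prod r a b" "approx_prod r a b \<le> 1"
  by (auto simp: approx_prod_def)

text \<open>If one factor is 0, the minimum is 0 and both sawtooth arguments are half of the other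
  factor, so the interpolation errors cancel exactly.\<close>

lemma approx_prod_zero:
  assumes "0 \<le> a" "0 \<le> b"
  shows "approx_prod r a 0 = 0" "approx_prod r 0 b = 0"
  using assms by (auto simp: approx_prod_def raw_prod_def)

text \<open>By polarization, \<open>a b = min a b - s ((a + b) / 2) + s (\<bar>a - b\<bar> / 2)\<close> with \<open>s t = t - t\<^sup>2\<close>.\<close>

lemma approx_prod_error:
  assumes "0 \<le> a" "a \<le> 1" "0 \<le> b" "b \<le> 1"
  shows "\<bar>approx_prod r a b - a * b\<bar> \<le> 1 / 4 ^ r"
proof -
  define u v where "u = (a + b) / 2" and "v = \<bar>a - b\<bar> / 2"
  have uv: "0 \<le> u" "u \<le> 1" "0 \<le> v" "v \<le> 1" using assms by (auto simp: u_def v_def abs_if)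
  have "a * b = min a b - (u - u\<^sup>2) + (v - v\<^sup>2)"
    by (auto simp: u_def v_def min_def abs_if power2_eq_square field_simps)
  then have "raw_prod r a b - a * b = (u - u\<^sup>2 - sawtooth r u) - (v - v\<^sup>2 - sawtooth r v)"
    by (simp add: raw_prod_def u_def v_def)
  then have "\<bar>raw_prod r a b - a * b\<bar> \<le> 1 / 4 ^ Suc r"
    using sawtooth_error[OF uv(1,2), of r] sawtooth_error[OF uv(3,4), of r] by linarith
  also have "\<dots> \<le> 1 / 4 ^ r" by (simp add: field_simps)
  finally have "\<bar>raw_prod r a b - a * b\<bar> \<le> 1 / 4 ^ r" .
  moreover have "0 \<le> a * b" "a * b \<le> 1" using assms by (auto intro: mult_le_one)
  \<comment> \<open>Clipping to [0,1] does not move the value away from \<open>a * b\<close>, which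
    lies in that interval.\<close>
  ultimately show ?thesis unfolding approx_prod_def by linarith
qed

text \<open>One layer of 4 neurons splits \<open>a - b\<close> into its positive and negative part,
  r + 1 layers of 5 iterate the tent maps, and two single neurons clip. This gives the depth r + 4
  and 4 + 5(r + 1) + 2 = 5r + 11 neurons. The bounds on \<open>a\<close> and \<open>b\<close> are
  assumed at all vectors because neurons are total functions.\<close>

lemma computes_approx_prod:
  assumes comp: "computes d L M T" and ab: "a \<in> T" "b \<in> T"
    and ra: "\<And>x. 0 \<le> a x \<and> a x \<le> 1" and rb: "\<And>x. 0 \<le> b x \<and> b x \<le> 1"
  shows "computes d (L + (r + 4)) (M + (5 * r + 11)) {\<lambda>x. approx_prod r (a x) (b x)}"
proof -
  define u v where "u x = (a x + b x) / 2" and "v x = \<bar>a x - b x\<bar> / 2" for x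
  have uv: "0 \<le> u x" "u x \<le> 1" "0 \<le> v x" "v x \<le> 1" for x
    using ra[of x] rb[of x] by (auto simp: u_def v_def abs_if)
  define p where "p j w x = (tent ^^ j) (w x)" for j and w :: "real vec \<Rightarrow> real" and x
  define q where "q j w x = relu ((tent ^^ j) (w x) - 1/2)" for j and w :: "real vec \<Rightarrow> real" and x
  \<comment> \<open>The accumulator of \<open>raw_prod\<close>. The offset 2 keeps it nonnegative,
    so that it passes each activation unchanged.\<close>
  define A where "A j x = 2 + min (a x) (b x) - sawtooth j (u x) + sawtooth j (v x)" for j x
  define S where "S j = {p j u, q j u, p j v, q j v, A j}" for j
  let ?ra = "\<lambda>x. relu (a x - b x)" and ?rb = "\<lambda>x. relu (b x - a x)"
  let ?T1 = "{a, b, ?ra, ?rb}"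
  have v: "v x = 1/2 * relu (a x - b x) + 1/2 * relu (b x - a x)" for x by (auto simp: v_def relu_def)
  have 1: "computes d (Suc L) (M + 4) ?T1"
  proof (rule computes.layer[OF comp])
    show "card ?T1 \<le> 4" by (simp add: card_insert_if)
    have "neuron T a" by (rule neuronI[of "[(1, a)]" _ _ 0]) (use ab ra in \<open>auto simp: relu_def\<close>)
    moreover have "neuron T b" by (rule neuronI[of "[(1, b)]" _ _ 0]) (use ab rb in \<open>auto simp: relu_def\<close>)
    moreover have "neuron T ?ra" by (rule neuronI[of "[(1, a), (-1, b)]" _ _ 0]) (use ab in auto)
    moreover have "neuron T ?rb" by (rule neuronI[of "[(1, b), (-1, a)]" _ _ 0]) (use ab in auto)
    ultimately show "\<forall>f\<in>?T1. neuron T f" by blast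
  qed auto
  have S: "card (S j) \<le> 5" "finite (S j)" "S j \<noteq> {}" for j by (auto simp: S_def card_insert_if)
  have pu: "0 \<le> p j u x" "0 \<le> p j v x" for j x
    using funpow_tent_range uv by (auto simp: p_def)
  have A0: "0 \<le> A j x" for j x
    using sawtooth_range[of "u x" j] sawtooth_range[of "v x" j] uv[of x] ra[of x] rb[of x] by (auto simp: A_def min_def)
  have 2: "computes d (L + (j + 2)) (M + 4 + 5 * Suc j) (S j)" for j
  proof (induction j)
    case 0
    have "computes d (Suc (Suc L)) (M + 4 + 5) (S 0)"
    proof (rule computes.layer[OF 1 S(2,3,1)])
      have "neuron ?T1 (p 0 u)"
        by (rule neuronI[of "[(1/2, a), (1/2, b)]" _ _ 0]) (use ra rb in \<open>auto simp: p_def u_def relu_def\<close>)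
      moreover have "neuron ?T1 (q 0 u)"
        by (rule neuronI[of "[(1/2, a), (1/2, b)]" _ _ "-1/2"]) (auto simp: q_def u_def add_divide_distrib)
      moreover have "neuron ?T1 (p 0 v)"
        by (rule neuronI[of "[(1/2, ?ra), (1/2, ?rb)]" _ _ 0]) (auto simp: p_def v relu_def[of "relu _ / 2 + _"] relu_nonneg)
      moreover have "neuron ?T1 (q 0 v)"
        by (rule neuronI[of "[(1/2, ?ra), (1/2, ?rb)]" _ _ "-1/2"]) (auto simp: q_def v)
      moreover have "neuron ?T1 (A 0)"
        by (rule neuronI[of "[(1, b), (-1, ?rb)]" _ _ 2]) (use ra rb in \<open>auto simp: A_def sawtooth_def relu_def\<close>)
      ultimately show "\<forall>f\<in>S 0. neuron ?T1 f" unfolding S_def by blast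
    qed
    then show ?case by simp
  next
    case (Suc j)
    have tw: "(tent ^^ Suc j) (w x) = 2 * p j w x - 4 * q j w x" for w x
      by (simp add: p_def q_def tent_def)
    have "computes d (Suc (L + (j + 2))) (M + 4 + 5 * Suc j + 5) (S (Suc j))"
    proof (rule computes.layer[OF Suc.IH S(2,3,1)])
      have w: "neuron (S j) (p (Suc j) w)" "neuron (S j) (q (Suc j) w)" if "w \<in> {u, v}" for w
      proof -
        have s: "p j w \<in> S j" "q j w \<in> S j" using that by (auto simp: S_def)
        have nn: "0 \<le> p (Suc j) w x" for x using that pu by auto
        show "neuron (S j) (p (Suc j) w)"
          by (rule neuronI[of "[(2, p j w), (-4, q j w)]" _ _ 0])
             (use s nn in \<open>auto simp: p_def[of "Suc j"] tw relu_def simp del: funpow.simps\<close>)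
        show "neuron (S j) (q (Suc j) w)"
          by (rule neuronI[of "[(2, p j w), (-4, q j w)]" _ _ "-1/2"])
             (use s in \<open>auto simp: q_def[of "Suc j"] tw simp del: funpow.simps\<close>)
      qed
      have "neuron (S j) (A (Suc j))"
      proof (rule neuronI[of "[(1, A j), (- 2 / 4 ^ Suc j, p j u), (4 / 4 ^ Suc j, q j u), (2 / 4 ^ Suc j, p j v), (- 4 / 4 ^ Suc j, q j v)]" _ _ 0])
        fix x
        have "A (Suc j) x = A j x - (2 * p j u x - 4 * q j u x) / 4 ^ Suc j + (2 * p j v x - 4 * q j v x) / 4 ^ Suc j"
          unfolding A_def sawtooth_def sum.lessThan_Suc tw by simp
        also have "\<dots> = A j x + (- 2 / 4 ^ Suc j * p j u x + (4 / 4 ^ Suc j * q j u x + (2 / 4 ^ Suc j * p j v x + - 4 / 4 ^ Suc j * q j v x)))"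
          by (simp add: diff_divide_distrib)
        finally show "A (Suc j) x = relu (0 + (\<Sum>(w, g)\<leftarrow>[(1, A j), (- 2 / 4 ^ Suc j, p j u), (4 / 4 ^ Suc j, q j u), (2 / 4 ^ Suc j, p j v), (- 4 / 4 ^ Suc j, q j v)]. w * g x))"
          using A0[of "Suc j" x] by (simp add: relu_def)
      qed (auto simp: S_def)
      then show "\<forall>f\<in>S (Suc j). neuron (S j) f" using w unfolding S_def[of "Suc j"] by blast
    qed
    then show ?case by (simp add: add_ac)
  qed
  have 3: "computes d (Suc (L + (r + 2))) (M + 4 + 5 * Suc r + 1) {\<lambda>x. relu (3 - A r x)}"
  proof (rule computes.layer[OF 2])
    show "\<forall>f\<in>{\<lambda>x. relu (3 - A r x)}. neuron (S r) f"
      by (intro ballI neuronI[of "[(-1, A r)]" _ _ 3]) (auto simp: S_def)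
  qed auto
  have 4: "computes d (Suc (Suc (L + (r + 2)))) (M + 4 + 5 * Suc r + 1 + 1) {\<lambda>x. approx_prod r (a x) (b x)}"
  proof (rule computes.layer[OF 3])
    \<comment> \<open>With y = \<open>A r x - 2\<close>, the two last layers compute relu (1 - relu
      (1 - y)), which is y clipped to [0,1].\<close>
    have e: "raw_prod r (a x) (b x) = A r x - 2" for x by (simp add: raw_prod_def A_def u_def v_def)
    show "\<forall>f\<in>{\<lambda>x. approx_prod r (a x) (b x)}. neuron {\<lambda>x. relu (3 - A r x)} f"
      by (intro ballI neuronI[of "[(-1, \<lambda>x. relu (3 - A r x))]" _ _ 1]) (auto simp: approx_prod_def e relu_def)
  qed auto
  have "L + (r + 4) = Suc (Suc (L + (r + 2)))" "M + (5 * r + 11) = M + 4 + 5 * Suc r + 1 + 1" by simp_all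
  then show ?thesis using 4 by (simp only:)
qed

fun prod_tree :: "nat \<Rightarrow> nat \<Rightarrow> (nat \<Rightarrow> real vec \<Rightarrow> real) \<Rightarrow> nat \<Rightarrow> real vec \<Rightarrow> real" where
  "prod_tree r 0 a i = a i"
| "prod_tree r (Suc n) a i = (\<lambda>x. approx_prod r (prod_tree r n a i x) (prod_tree r n a (i + 2 ^ n) x))"

lemma prod_tree_range:
  assumes "\<And>i x. 0 \<le> a i x \<and> a i x \<le> 1"
  shows "0 \<le> prod_tree r n a i x \<and> prod_tree r n a i x \<le> 1"
  using assms by (cases n) (auto simp: approx_prod_range)

lemma prod_tree_zero:
  assumes "\<And>i x. 0 \<le> a i x \<and> a i x \<le> 1"
  shows "a (i + j) x = 0 \<Longrightarrow> j < 2 ^ n \<Longrightarrow> prod_tree r n a i x = 0"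
proof (induction n arbitrary: i j)
  case (Suc n)
  show ?case
  proof (cases "j < 2 ^ n")
    case True
    then show ?thesis using Suc prod_tree_range[of a, OF assms] by (auto intro!: approx_prod_zero)
  next
    case False
    then have "a (i + 2 ^ n + (j - 2 ^ n)) x = 0" "j - 2 ^ n < 2 ^ n" using Suc.prems by auto
    then show ?thesis using Suc.IH[of "i + 2 ^ n"] prod_tree_range[of a, OF assms] by (auto intro!: approx_prod_zero)
  qed
qed auto

lemma prod_lessThan_add:
  fixes f :: "nat \<Rightarrow> 'a::comm_monoid_mult"
  shows "(\<Prod>j<m + k. f j) = (\<Prod>j<m. f j) * (\<Prod>j<k. f (m + j))"
  by (induction k) (auto simp: mult.assoc)

text \<open>A tree of height \<open>n\<close> contains 2^n - 1 multiplications. As all factors lie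
  in [0,1], the errors of the two subtrees are not amplified and simply add, together with that of
  the root.\<close>

lemma prod_tree_error:
  assumes "\<And>i x. 0 \<le> a i x \<and> a i x \<le> 1"
  shows "\<bar>prod_tree r n a i x - (\<Prod>j<2^n. a (i + j) x)\<bar> \<le> (2 ^ n - 1) / 4 ^ r"
proof (induction n arbitrary: i)
  case (Suc n)
  define s t S T where "s = prod_tree r n a i x" and "t = prod_tree r n a (i + 2 ^ n) x"
    and "S = (\<Prod>j<2^n. a (i + j) x)" and "T = (\<Prod>j<2^n. a (i + 2 ^ n + j) x)"
  have r: "0 \<le> s \<and> s \<le> 1" "0 \<le> t \<and> t \<le> 1" unfolding s_def t_def by (intro prod_tree_range assms)+
  have R: "0 \<le> T \<and> T \<le> 1" unfolding T_def using assms by (auto intro: prod_nonneg prod_le_1)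
  have IH: "\<bar>s - S\<bar> \<le> (2 ^ n - 1) / 4 ^ r" "\<bar>t - T\<bar> \<le> (2 ^ n - 1) / 4 ^ r"
    unfolding s_def t_def S_def T_def by (rule Suc.IH)+
  have "\<bar>s * t - S * T\<bar> = \<bar>s * (t - T) + (s - S) * T\<bar>" by (simp add: algebra_simps)
  also have "\<dots> \<le> \<bar>s\<bar> * \<bar>t - T\<bar> + \<bar>s - S\<bar> * \<bar>T\<bar>" by (simp add: abs_mult[symmetric])
  also have "\<dots> \<le> 1 * ((2 ^ n - 1) / 4 ^ r) + (2 ^ n - 1) / 4 ^ r * 1"
    using r R IH by (intro add_mono mult_mono) auto
  finally have "\<bar>s * t - S * T\<bar> \<le> 2 * (2 ^ n - 1) / 4 ^ r" by simp
  moreover have "\<bar>approx_prod r s t - s * t\<bar> \<le> 1 / 4 ^ r" using r by (intro approx_prod_error) auto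
  ultimately have "\<bar>approx_prod r s t - S * T\<bar> \<le> 2 * (2 ^ n - 1) / 4 ^ r + 1 / 4 ^ r" by linarith
  also have "\<dots> = (2 ^ Suc n - 1) / 4 ^ r" by (simp add: field_simps)
  finally have "\<bar>approx_prod r s t - S * T\<bar> \<le> (2 ^ Suc n - 1) / 4 ^ r" .
  moreover have "(2::nat) ^ Suc n = 2 ^ n + 2 ^ n" by simp
  then have "(\<Prod>j<2^Suc n. a (i + j) x) = S * T"
    unfolding S_def T_def by (simp only: prod_lessThan_add add.assoc)
  ultimately show ?case by (simp only: prod_tree.simps s_def t_def)
qed auto

lemma computes_prod_tree:
  assumes "\<And>i x. 0 \<le> a i x \<and> a i x \<le> 1" "\<And>i. computes d L M {a i}"
  shows "computes d (L + n * (r + 4)) (2 ^ n * M + (2 ^ n - 1) * (5 * r + 11)) {prod_tree r n a i}"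
proof (induction n arbitrary: i)
  case (Suc n)
  let ?N = "2 ^ n * M + (2 ^ n - 1) * (5 * r + 11)"
  have "computes d (L + n * (r + 4) + (r + 4)) (?N + ?N + (5 * r + 11)) {prod_tree r (Suc n) a i}"
    unfolding prod_tree.simps
    by (rule computes_approx_prod[OF computes_Un[OF Suc.IH[of i] Suc.IH[of "i + 2 ^ n"]]])
       (use prod_tree_range[of a, OF assms(1)] in auto)
  moreover have "?N + ?N + (5 * r + 11) = 2 ^ Suc n * M + (2 ^ Suc n - 1) * (5 * r + 11)"
  proof -
    obtain k where "(2::nat) ^ n = Suc k" using not0_implies_Suc[of "2 ^ n :: nat"] by auto
    then have "(2::nat) ^ Suc n - 1 = (2 ^ n - 1) + (2 ^ n - 1) + 1" by simp
    then show ?thesis by (simp only: distrib_right) simp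
  qed
  moreover have "L + n * (r + 4) + (r + 4) = L + Suc n * (r + 4)" by simp
  ultimately show ?case by (simp only:)
qed (use assms in simp)

text \<open>The indices \<open>i \<ge> d\<close> pad the factors of a basis function to a power of two.\<close>

definition leaf :: "nat \<Rightarrow> (nat \<times> nat) list \<Rightarrow> nat \<Rightarrow> real vec \<Rightarrow> real" where
  "leaf d p i x = (if i < d then faber (p ! i) (x $ (d - 1 - i)) else 1)"

lemma leaf_range: "0 \<le> leaf d p i x \<and> leaf d p i x \<le> 1"
  by (simp add: leaf_def faber_range)

text \<open>Two neurons for the absolute value and one for the hat. A padding leaf is a neuron
  without inputs and with bias 1, placed at the same depth so that all leaves enter the tree
  together.\<close>

lemma computes_leaf:
  assumes "0 < d"
  shows "computes d 2 3 {leaf d p i}"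
proof -
  let ?I = "(\<lambda>i (x :: real vec). x $ i) ` {..<d}"
  obtain k s where q: "p ! i = (k, s)" by (cases "p ! i")
  define y where "y x = 2 ^ Suc k * (x $ (d - 1 - i)) - (2 * real s + 1)" for x :: "real vec"
  let ?T = "{\<lambda>x. relu (y x), \<lambda>x. relu (- y x)}"
  have 1: "computes d (Suc 0) (0 + 2) ?T"
  proof (rule computes.layer[OF computes.input])
    show "card ?T \<le> 2" by (simp add: card_insert_if)
    have m: "(\<lambda>x. x $ (d - 1 - i)) \<in> ?I" using assms by (intro image_eqI[where x = "d - 1 - i"]) auto
    have "neuron ?I (\<lambda>x. relu (y x))"
      by (rule neuronI[of "[(2 ^ Suc k, \<lambda>x. x $ (d - 1 - i))]" _ _ "- (2 * real s + 1)"]) (use m in \<open>auto simp: y_def intro!: arg_cong[where f = relu]\<close>)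
    moreover have "neuron ?I (\<lambda>x. relu (- y x))"
      by (rule neuronI[of "[(- (2 ^ Suc k), \<lambda>x. x $ (d - 1 - i))]" _ _ "2 * real s + 1"]) (use m in \<open>auto simp: y_def intro!: arg_cong[where f = relu]\<close>)
    ultimately show "\<forall>f\<in>?T. neuron ?I f" by blast
  qed auto
  have "computes d (Suc (Suc 0)) (0 + 2 + 1) {leaf d p i}"
  proof (rule computes.layer[OF 1])
    have "neuron ?T (leaf d p i)"
    proof (cases "i < d")
      case True
      show ?thesis
        by (rule neuronI[of "[(-1, \<lambda>x. relu (y x)), (-1, \<lambda>x. relu (- y x))]" _ _ 1])
           (use True in \<open>auto simp: leaf_def q faber.simps hat_def y_def intro!: arg_cong[where f = relu]\<close>)
    next
      case False
      show ?thesis by (rule neuronI[of "[]" _ _ 1]) (use False in \<open>auto simp: leaf_def relu_def\<close>)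
    qed
    then show "\<forall>f\<in>{leaf d p i}. neuron ?T f" by blast
  qed auto
  then show ?thesis by (simp add: eval_nat_numeral)
qed

section \<open>Choice of the parameters\<close>

lemma grid_const_le: "real (grid_const d m) \<le> (real m + real d) ^ d"
proof (cases d)
  case (Suc n)
  have "real (grid_const d m) \<le> real ((m + d) ^ n)"
    unfolding Suc grid_const.simps of_nat_le_iff by (rule binomial_le_pow) simp
  also have "\<dots> \<le> real ((m + d) ^ d)" unfolding of_nat_le_iff using Suc by (intro power_increasing) auto
  finally show ?thesis by simp
qed auto

lemma sparse_error_tendsto_0:
  assumes "0 < (\<alpha>::real)"
  shows "(\<lambda>m. 2 powr (- \<alpha> * real (Suc m)) * real (grid_const d m)) \<longlonglongrightarrow> 0"
proof (rule tendsto_sandwich[of "\<lambda>_. 0"])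
  show "\<forall>\<^sub>F m in sequentially. 2 powr (- \<alpha> * real (Suc m)) * real (grid_const d m) \<le>
      2 powr (- \<alpha> * real (Suc m)) * (real m + real d) powr real d"
  proof (rule eventually_mono[OF eventually_gt_at_top[of 0]])
    fix m :: nat assume "0 < m"
    then show "2 powr (- \<alpha> * real (Suc m)) * real (grid_const d m) \<le>
        2 powr (- \<alpha> * real (Suc m)) * (real m + real d) powr real d"
      using grid_const_le[of d m] by (intro mult_left_mono) (auto simp: powr_realpow)
  qed
  show "(\<lambda>m. 2 powr (- \<alpha> * real (Suc m)) * (real m + real d) powr real d) \<longlonglongrightarrow> 0"
    using assms by real_asymp
qed auto

lemma log_over_linear:
  assumes "0 < (\<alpha>::real)" "0 < c"
  obtains m0 :: nat where "\<And>m. m0 \<le> m \<Longrightarrow> c * log 2 (real m + real d) \<le> \<alpha> / 2 * real m"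
proof -
  have "\<forall>\<^sub>F m in sequentially. c * log 2 (real m + real d) \<le> \<alpha> / 2 * real m"
    using assms by real_asymp
  then show ?thesis using that by (auto simp: eventually_sequentially)
qed

text \<open>\<open>m\<close> is the least level meeting the first inequality. Its failure at
  \<open>m - 1\<close> is the second one; there \<open>grid_const\<close> is exactly the binomial
  coefficient that also counts the grid points of level \<open>m\<close>.\<close>

lemma sparse_parameters:
  fixes \<alpha> :: real and d :: nat
  assumes "0 < \<alpha>" "\<alpha> \<le> 1" "2 \<le> d"
  shows "\<exists>\<epsilon>\<^sub>0\<in>{0<..1::real}. \<forall>\<epsilon>\<in>{0<..<\<epsilon>\<^sub>0}. \<exists>m.
     2 powr (- \<alpha> * real (Suc m)) * real (grid_const d m) \<le> \<epsilon> / 2 \<and>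
     2 powr (\<alpha> * real m) \<le> 2 / \<epsilon> * real ((m + (d - 1)) choose (d - 1)) \<and>
     real m + real d \<le> 4 / \<alpha> * log 2 (2 / \<epsilon>) \<and>
     real d * real (Suc m) ^ d \<le> 1 / \<epsilon>"
proof -
  obtain m0 where m0: "\<And>m. m0 \<le> m \<Longrightarrow> real (d - 1) * log 2 (real m + real d) \<le> \<alpha> / 2 * real m"
    using log_over_linear[of \<alpha> "real (d - 1)" d] assms by auto
  have "\<forall>\<^sub>F L in at_top. real d * (4 / \<alpha> * L) powr real d \<le> 2 powr L / 2"
    using assms by real_asymp
  then obtain L1 where L1: "\<And>L. L1 \<le> L \<Longrightarrow> real d * (4 / \<alpha> * L) powr real d \<le> 2 powr L / 2"
    by (auto simp: eventually_at_top_linorder)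
  define L0 where "L0 = max (real m0 + real d) L1"
  have L0: "1 \<le> L0" "real m0 + real d \<le> L0" "L1 \<le> L0" using assms by (auto simp: L0_def)
  show ?thesis
  \<comment> \<open>This threshold says that log (2/\<epsilon>) exceeds \<open>L0\<close>.\<close>
  proof (rule bexI[of _ "2 powr (1 - L0)"], intro ballI)
    show "2 powr (1 - L0) \<in> {0<..1}" using L0 powr_mono[of "1 - L0" 0 2] by auto
    fix \<epsilon> :: real assume "\<epsilon> \<in> {0<..<2 powr (1 - L0)}"
    then have eps: "0 < \<epsilon>" "\<epsilon> < 2 powr (1 - L0)" by auto
    define L where "L = log 2 (2 / \<epsilon>)"
    have pL: "2 powr L = 2 / \<epsilon>" using eps by (simp add: L_def)
    have LL: "L0 \<le> L"
    proof -
      have "2 powr L0 * \<epsilon> \<le> 2 powr L0 * 2 powr (1 - L0)" using eps by (intro mult_left_mono) auto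
      also have "\<dots> = 2" by (simp add: powr_add[symmetric])
      finally have "2 powr L0 \<le> 2 / \<epsilon>" using eps by (simp add: field_simps)
      then show ?thesis unfolding L_def using eps by (subst le_log_iff) auto
    qed
    let ?P = "\<lambda>m. 2 powr (- \<alpha> * real (Suc m)) * real (grid_const d m) \<le> \<epsilon> / 2"
    have "\<forall>\<^sub>F m in sequentially. 2 powr (- \<alpha> * real (Suc m)) * real (grid_const d m) < \<epsilon> / 2"
      by (rule order_tendstoD(2)[OF sparse_error_tendsto_0[OF assms(1)]]) (use eps in simp)
    then obtain m' where "?P m'" by (auto simp: eventually_sequentially intro: less_imp_le)
    define m where "m = (LEAST m. ?P m)"
    have Pm: "?P m" unfolding m_def by (rule LeastI[of ?P, OF \<open>?P m'\<close>])
    let ?C = "real ((m + (d - 1)) choose (d - 1))"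
    have C1: "1 \<le> ?C" by (simp add: Suc_le_eq zero_less_binomial)
    have 2: "2 powr (\<alpha> * real m) \<le> 2 / \<epsilon> * ?C"
    proof (cases m)
      case 0
      have "1 \<le> 2 / \<epsilon>" using LL L0 unfolding pL[symmetric] by (simp add: ge_one_powr_ge_zero)
      then have "1 * 1 \<le> 2 / \<epsilon> * ?C" using C1 eps by (intro mult_mono) auto
      then show ?thesis using eps by (simp add: 0)
    next
      case (Suc k)
      have "\<not> ?P k" using not_less_Least[of k ?P] Suc unfolding m_def by simp
      moreover have "grid_const d k = (m + (d - 1)) choose (d - 1)"
        using assms(3) by (cases d) (auto simp: Suc)
      ultimately have "\<epsilon> / 2 < 2 powr (- \<alpha> * real m) * ?C" using Suc by simp
      then have "2 powr (\<alpha> * real m) * (\<epsilon> / 2) \<le> 2 powr (\<alpha> * real m) * (2 powr (- \<alpha> * real m) * ?C)"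
        by (intro mult_left_mono) auto
      also have "\<dots> = ?C" by (simp add: powr_add[symmetric] mult.assoc[symmetric])
      finally show ?thesis using eps by (simp add: field_simps)
    qed
    \<comment> \<open>For \<open>m\<close> beyond \<open>m0\<close> the binomial is at most
      \<open>2 powr (\<alpha> / 2 * m)\<close>, so half of the exponent \<alpha> m is absorbed and
      the other half is bounded by \<open>L\<close>.\<close>
    have m_le: "real m \<le> real m0 + 2 / \<alpha> * L"
    proof (cases "m0 \<le> m")
      case True
      have pos: "0 < real m + real d" using assms(3) by simp
      have "?C \<le> real ((m + (d - 1)) ^ (d - 1))" unfolding of_nat_le_iff by (rule binomial_le_pow) simp
      also have "\<dots> \<le> (real m + real d) ^ (d - 1)" unfolding of_nat_power by (intro power_mono) auto
      also have "\<dots> = (real m + real d) powr real (d - 1)" using pos by (simp add: powr_realpow)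
      also have "\<dots> = (2 powr log 2 (real m + real d)) powr real (d - 1)" using pos by simp
      also have "\<dots> = 2 powr (real (d - 1) * log 2 (real m + real d))"
        by (simp only: powr_powr mult.commute)
      also have "\<dots> \<le> 2 powr (\<alpha> / 2 * real m)" using m0[OF True] by (intro powr_mono) auto
      finally have "2 powr (\<alpha> * real m) \<le> 2 powr L * 2 powr (\<alpha> / 2 * real m)"
        using 2 eps unfolding pL by (elim order.trans) (auto intro!: divide_right_mono mult_left_mono)
      then have "\<alpha> * real m \<le> L + \<alpha> / 2 * real m" by (simp add: powr_add[symmetric])
      then have "real m \<le> 2 / \<alpha> * L" using assms by (simp add: field_simps)
      then show ?thesis by simp
    next
      case False
      have "0 \<le> 2 / \<alpha> * L" using assms LL L0 by simp
      then show ?thesis using False by simp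
    qed
    \<comment> \<open>Since \<open>L\<close> dominates \<open>m0 + d\<close> and L \<le> L/\<alpha>,
      the sum m + d is at most 3 L/\<alpha>. The bound 4 L/\<alpha> is the form matching the factor
      4/\<alpha> in \<open>K1_const\<close>.\<close>
    have "L * \<alpha> \<le> L * 1" using assms LL L0 by (intro mult_left_mono) auto
    then have "L \<le> L / \<alpha>" using assms(1) by (simp add: field_simps)
    moreover have "2 / \<alpha> * L = 2 * (L / \<alpha>)" "4 / \<alpha> * L = 4 * (L / \<alpha>)" by simp_all
    ultimately have 3: "real m + real d \<le> 4 / \<alpha> * L" using m_le L0 LL by linarith
    have "real d * real (Suc m) ^ d \<le> real d * (4 / \<alpha> * L) ^ d"
      using 3 assms(3) by (intro mult_left_mono power_mono) auto
    also have "\<dots> = real d * (4 / \<alpha> * L) powr real d" using assms LL L0 by (simp add: powr_realpow)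
    also have "\<dots> \<le> 2 powr L / 2" using LL L0 by (intro L1) auto
    finally have "real d * real (Suc m) ^ d \<le> 1 / \<epsilon>" using pL by simp
    then show "\<exists>m. ?P m \<and> 2 powr (\<alpha> * real m) \<le> 2 / \<epsilon> * real ((m + (d - 1)) choose (d - 1)) \<and>
       real m + real d \<le> 4 / \<alpha> * log 2 (2 / \<epsilon>) \<and> real d * real (Suc m) ^ d \<le> 1 / \<epsilon>"
      using Pm 2 3 by (auto simp: L_def)
  qed
qed

section \<open>The approximating network\<close>

lemma rev_arg_list_of_vec: "rev_arg f (rev (list_of_vec x)) = f x"
  by (simp add: rev_arg_def vec_list)

text \<open>The reversal of the list matches the index \<open>d - 1 - i\<close> in
  \<open>leaf\<close>: basis functions take the last coordinate first.\<close>

lemma prod_leaf: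
  assumes "length p = d" "x \<in> carrier_vec d" "d \<le> 2 ^ n"
  shows "(\<Prod>j<2^n. leaf d p j x) = sparse_basis p (rev (list_of_vec x))"
proof -
  have "(\<Prod>j<2^n. leaf d p j x) = (\<Prod>j<d. leaf d p j x)"
    by (rule prod.mono_neutral_right) (use assms(3) in \<open>auto simp: leaf_def\<close>)
  also have "\<dots> = (\<Prod>j<d. faber (p ! j) (rev (list_of_vec x) ! j))"
    by (intro prod.cong) (use assms in \<open>auto simp: leaf_def rev_nth list_of_vec_index\<close>)
  also have "\<dots> = sparse_basis p (rev (list_of_vec x))"
    using assms by (simp add: sparse_basis_def prod.list_conv_set_nth atLeast0LessThan)
  finally show ?thesis .
qed

abbreviation sparse_net :: "nat \<Rightarrow> nat \<Rightarrow> nat \<Rightarrow> (nat \<times> nat) list \<Rightarrow> real vec \<Rightarrow> real" where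
  "sparse_net d r n p \<equiv> prod_tree r n (leaf d p) 0"

lemma cube_list:
  assumes "x \<in> cube d"
  shows "x \<in> carrier_vec d" "length (rev (list_of_vec x)) = d" "set (rev (list_of_vec x)) \<subseteq> {0..1}"
proof -
  show x: "x \<in> carrier_vec d" using assms by (simp add: cube_def)
  show "length (rev (list_of_vec x)) = d" using x by simp
  show "set (rev (list_of_vec x)) \<subseteq> {0..1}"
    using assms x by (auto simp: cube_def in_set_conv_nth list_of_vec_index)
qed

lemma sparse_net_error:
  assumes "f \<in> U0_ball d \<alpha>" "0 \<le> \<alpha>" "x \<in> cube d" "d \<le> 2 ^ n"
  shows "\<bar>f x - (\<Sum>p\<in>sparse_index d m. sparse_coeff p (rev_arg f) * sparse_net d r n p x)\<bar>
     \<le> 2 powr (- \<alpha> * real (Suc m)) * real (grid_const d m) + real (Suc m) ^ d * (2 ^ n / 4 ^ r)"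
proof -
  define xs where "xs = rev (list_of_vec x)"
  note x = cube_list[OF assms(3), folded xs_def]
  let ?J = "sparse_index d m" and ?c = "\<lambda>p. sparse_coeff p (rev_arg f)"
  have mix: "hoelder_mix \<alpha> d 1 (rev_arg f)" by (rule U0_ball_hoelder_mix[OF assms(1)])
  have basis: "(\<Prod>j<2^n. leaf d p j x) = sparse_basis p xs" if "p \<in> ?J" for p
    unfolding xs_def using length_sparse_index[OF that] x(1) assms(4) by (intro prod_leaf) auto
  have 1: "\<bar>f x - sparse_interp d m (rev_arg f) xs\<bar> \<le> 2 powr (- \<alpha> * real (Suc m)) * real (grid_const d m)"
    using sparse_interp_error[OF mix U0_ball_vanishing[OF assms(1)] assms(2) _ x(2,3), of m]
    by (simp only: xs_def rev_arg_list_of_vec) simp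
  have term_le: "\<bar>?c p * (sparse_basis p xs - sparse_net d r n p x)\<bar>
     \<le> (if sparse_basis p xs \<noteq> 0 then 2 ^ n / 4 ^ r else 0)" if p: "p \<in> ?J" for p
  proof (cases "sparse_basis p xs = 0")
    case True
    then obtain j where "j < 2 ^ n" "leaf d p j x = 0"
      using basis[OF p] by (auto simp: prod_zero_iff)
    then have "sparse_net d r n p x = 0"
      using prod_tree_zero[of "leaf d p" 0 j x n r] leaf_range by simp
    then show ?thesis using True by simp
  next
    case False
    have "\<bar>sparse_net d r n p x - sparse_basis p xs\<bar> \<le> (2 ^ n - 1) / 4 ^ r"
      using prod_tree_error[of "leaf d p" r n 0 x] leaf_range basis[OF p] by simp
    also have "\<dots> \<le> 2 ^ n / 4 ^ r" by (intro divide_right_mono) auto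
    finally have "\<bar>?c p\<bar> * \<bar>sparse_basis p xs - sparse_net d r n p x\<bar> \<le> 1 * (2 ^ n / 4 ^ r)"
      using sparse_coeff_bound[OF mix p assms(2)] by (intro mult_mono) auto
    then show ?thesis using False by (simp add: abs_mult)
  qed
  have "\<bar>sparse_interp d m (rev_arg f) xs - (\<Sum>p\<in>?J. ?c p * sparse_net d r n p x)\<bar>
     = \<bar>\<Sum>p\<in>?J. ?c p * (sparse_basis p xs - sparse_net d r n p x)\<bar>"
    by (simp add: sparse_interp_def sum_subtractf right_diff_distrib)
  also have "\<dots> \<le> (\<Sum>p\<in>?J. if sparse_basis p xs \<noteq> 0 then 2 ^ n / 4 ^ r else 0)"
    by (intro order.trans[OF sum_abs] sum_mono term_le)
  also have "\<dots> = real (card {p \<in> ?J. sparse_basis p xs \<noteq> 0}) * (2 ^ n / 4 ^ r)"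
    by (subst sum.inter_filter[symmetric]) simp_all
  also have "\<dots> \<le> real (Suc m ^ d) * (2 ^ n / 4 ^ r)"
    using card_sparse_support_le[OF x(2), of m] by (intro mult_right_mono) (auto simp del: of_nat_power)
  finally show ?thesis using 1 by simp
qed

section \<open>Measurability and the essential supremum\<close>

abbreviation cube_measure :: "nat \<Rightarrow> (nat \<Rightarrow> real) measure" where
  "cube_measure d \<equiv> Pi\<^sub>M {..<d} (\<lambda>_. restrict_space lborel {0..1})"

lemma vec_in_cube: "x \<in> space (cube_measure d) \<Longrightarrow> vec d x \<in> cube d"
  by (auto simp: space_PiM cube_def space_restrict_space PiE_iff)

lemma neuron_measurable:
  assumes "neuron T f" "\<And>g. g \<in> T \<Longrightarrow> (\<lambda>x. g (F x)) \<in> borel_measurable M"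
  shows "(\<lambda>x. f (F x)) \<in> borel_measurable M"
proof -
  obtain b ws where f: "snd ` set ws \<subseteq> T" "f = (\<lambda>x. relu (b + (\<Sum>(w, g)\<leftarrow>ws. w * g x)))"
    using assms(1) by (auto simp: neuron_def)
  from f(1) have [measurable]: "(\<lambda>x. \<Sum>(w, g)\<leftarrow>ws. w * g (F x)) \<in> borel_measurable M"
  proof (induction ws)
    case (Cons u ws)
    then have [measurable]: "(\<lambda>x. snd u (F x)) \<in> borel_measurable M"
      "(\<lambda>x. \<Sum>(w, g)\<leftarrow>ws. w * g (F x)) \<in> borel_measurable M"
      using assms(2) by auto
    show ?case by (simp add: case_prod_beta[of _ u])
  qed simp
  show ?thesis unfolding f(2) relu_def by measurable
qed

lemma computes_measurable:
  "computes d L M T \<Longrightarrow> g \<in> T \<Longrightarrow> (\<lambda>x. g (vec d x)) \<in> borel_measurable (cube_measure d)"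
proof (induction arbitrary: g rule: computes.induct)
  case (input M)
  then obtain i where i: "i < d" "g = (\<lambda>x. x $ i)" by auto
  have "(\<lambda>x. x i) \<in> measurable (cube_measure d) (restrict_space lborel {0..1})"
    using i(1) by (intro measurable_component_singleton) auto
  then have "(\<lambda>x. x i) \<in> borel_measurable (cube_measure d)"
    by (rule measurable_compose) (rule measurable_restrict_space1, simp)
  then show ?case using i by simp
next
  case (layer L M T T' k)
  then show ?case by (intro neuron_measurable[of T g "vec d"]) auto
qed

text \<open>The function is the pointwise limit of its sparse interpolants, which are finite
  combinations of products of leaves. This avoids comparing \<open>vec_topology\<close> with the
  product sigma-algebra. The number 2^d of leaves only has to be a power of two not below d.\<close>

lemma U0_ball_measurable:
  assumes "f \<in> U0_ball d \<alpha>" "0 < \<alpha>" "0 < d"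
  shows "(\<lambda>x. f (vec d x)) \<in> borel_measurable (cube_measure d)"
proof (rule borel_measurable_LIMSEQ_real)
  let ?xs = "\<lambda>x. rev (list_of_vec (vec d x))"
  fix x assume "x \<in> space (cube_measure d)"
  note cube = vec_in_cube[OF this]
  have le: "\<bar>f (vec d x) - sparse_interp d m (rev_arg f) (?xs x)\<bar> \<le> 2 powr (- \<alpha> * real (Suc m)) * real (grid_const d m)" for m
    using sparse_interp_error[OF U0_ball_hoelder_mix[OF assms(1)] U0_ball_vanishing[OF assms(1)] _ _ cube_list(2,3)[OF cube], of m] assms(2)
    by (simp only: rev_arg_list_of_vec) simp
  have "(\<lambda>m. f (vec d x) - sparse_interp d m (rev_arg f) (?xs x)) \<longlonglongrightarrow> 0"
    by (rule Lim_null_comparison[OF always_eventually sparse_error_tendsto_0[OF assms(2), of d]])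
       (simp only: real_norm_def le simp_thms)
  from tendsto_diff[OF tendsto_const[of "f (vec d x)"] this]
  show "(\<lambda>m. sparse_interp d m (rev_arg f) (?xs x)) \<longlonglongrightarrow> f (vec d x)" by simp
next
  fix m
  have "(\<lambda>x. sparse_interp d m (rev_arg f) (rev (list_of_vec (vec d x)))) =
     (\<lambda>x. \<Sum>p\<in>sparse_index d m. sparse_coeff p (rev_arg f) * (\<Prod>j<2^d. leaf d p j (vec d x)))"
    unfolding sparse_interp_def
    by (intro ext sum.cong refl arg_cong2[of _ _ _ _ "(*)"] prod_leaf[symmetric])
       (auto simp: length_sparse_index less_imp_le[OF less_exp])
  moreover have "(\<lambda>x. leaf d p j (vec d x)) \<in> borel_measurable (cube_measure d)" for p j
    by (rule computes_measurable[OF computes_leaf[OF assms(3)]]) simp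
  ultimately show "(\<lambda>x. sparse_interp d m (rev_arg f) (rev (list_of_vec (vec d x)))) \<in> borel_measurable (cube_measure d)"
    by simp
qed

lemma Linf_norm_le:
  assumes "\<And>x. x \<in> cube d \<Longrightarrow> \<bar>f x - g x\<bar> \<le> \<epsilon>" "0 \<le> \<epsilon>"
    and "(\<lambda>x. f (vec d x)) \<in> borel_measurable (cube_measure d)" "(\<lambda>x. g (vec d x)) \<in> borel_measurable (cube_measure d)"
  shows "Linf_norm d (\<lambda>x. f x - g x) \<le> ennreal \<epsilon>"
  unfolding Linf_norm_def
proof (rule esssup_I)
  show "(\<lambda>x. ennreal \<bar>f (vec d x) - g (vec d x)\<bar>) \<in> borel_measurable (cube_measure d)"
    using assms(3,4) by measurable
  show "AE x in cube_measure d. ennreal \<bar>f (vec d x) - g (vec d x)\<bar> \<le> ennreal \<epsilon>"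
    by (rule AE_I2) (use assms(1,2) vec_in_cube in \<open>auto intro: ennreal_leI\<close>)
qed

lemma sparse_architecture:
  fixes d n r m :: nat
  assumes "0 < d"
  defines "M \<equiv> 2 ^ n * 3 + (2 ^ n - 1) * (5 * r + 11)"
  shows "\<exists>A. is_architecture d A \<and> is_deep A \<and> last (net_dims A) = 1 \<and>
     net_size A \<le> (6 * M + 1) * card (sparse_index d m) \<and> net_depth A = n * (r + 4) + 3 \<and>
     (\<forall>c. \<exists>\<Phi>. is_network d \<Phi> \<and> is_deep \<Phi> \<and> has_architecture \<Phi> A \<and>
        (\<lambda>x. relu_output \<Phi> (vec d x) $ 0) \<in> borel_measurable (cube_measure d) \<and>
        (\<forall>x\<in>carrier_vec d. relu_output \<Phi> x $ 0 = (\<Sum>p\<in>sparse_index d m. c p * sparse_net d r n p x)))"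
proof -
  let ?J = "sparse_index d m" and ?F = "sparse_net d r n"
  have ne: "sparse_index d m \<noteq> {}" for d m
    by (induction d arbitrary: m) fastforce+
  have one: "computes d (2 + n * (r + 4)) M {?F p}" for p
    unfolding M_def by (intro computes_prod_tree leaf_range computes_leaf assms)
  have "(\<Union>p\<in>?J. {?F p}) = ?F ` ?J" by auto
  then have comp: "computes d (2 + n * (r + 4)) (card ?J * M) (?F ` ?J)"
    using computes_UN[OF finite_sparse_index ne one, of d m "\<lambda>p. p"] by (simp only:)
  have meas: "(\<lambda>x. ?F p (vec d x)) \<in> borel_measurable (cube_measure d)" for p
    by (rule computes_measurable[OF one]) simp
  obtain A where A: "is_architecture d A" "is_deep A" "last (net_dims A) = 1"
      "net_size A \<le> 6 * (card ?J * M) + card (?F ` ?J)" "net_depth A = Suc (2 + n * (r + 4))"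
      "\<And>c. \<exists>\<Phi>. is_network d \<Phi> \<and> is_deep \<Phi> \<and> has_architecture \<Phi> A \<and>
        (\<forall>x\<in>carrier_vec d. relu_output \<Phi> x $ 0 = (\<Sum>g\<in>?F ` ?J. c g * g x))"
    using computes_realization[OF comp] by auto
  have "\<exists>\<Phi>. is_network d \<Phi> \<and> is_deep \<Phi> \<and> has_architecture \<Phi> A \<and>
        (\<lambda>x. relu_output \<Phi> (vec d x) $ 0) \<in> borel_measurable (cube_measure d) \<and>
        (\<forall>x\<in>carrier_vec d. relu_output \<Phi> x $ 0 = (\<Sum>p\<in>?J. c p * ?F p x))" for c
  proof -
    \<comment> \<open>Output weights belong to functions, not to grid indices. Should several
      indices yield the same function, their coefficients are added.\<close>
    define c' where "c' g = (\<Sum>p\<in>{p \<in> ?J. ?F p = g}. c p)" for g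
    obtain \<Phi> where \<Phi>: "is_network d \<Phi>" "is_deep \<Phi>" "has_architecture \<Phi> A"
        "\<And>x. x \<in> carrier_vec d \<Longrightarrow> relu_output \<Phi> x $ 0 = (\<Sum>g\<in>?F ` ?J. c' g * g x)"
      using A(6)[of c'] by blast
    have "(\<Sum>g\<in>?F ` ?J. c' g * g x) = (\<Sum>p\<in>?J. c p * ?F p x)" for x
    proof -
      have "(\<Sum>g\<in>?F ` ?J. c' g * g x) = (\<Sum>g\<in>?F ` ?J. \<Sum>p\<in>{p \<in> ?J. ?F p = g}. c p * ?F p x)"
        unfolding c'_def sum_distrib_right by (intro sum.cong) auto
      also have "\<dots> = (\<Sum>p\<in>?J. c p * ?F p x)" by (rule sum.group) auto
      finally show ?thesis .
    qed
    then have out: "relu_output \<Phi> x $ 0 = (\<Sum>p\<in>?J. c p * ?F p x)" if "x \<in> carrier_vec d" for x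
      using \<Phi>(4)[OF that] by simp
    have "(\<lambda>x. relu_output \<Phi> (vec d x) $ 0) \<in> borel_measurable (cube_measure d)"
      using meas by (simp add: out)
    then show ?thesis using \<Phi>(1-3) out by blast
  qed
  moreover have "net_size A \<le> (6 * M + 1) * card ?J"
    using A(4) card_image_le[of ?J ?F] by (simp add: algebra_simps)
  moreover have "net_depth A = n * (r + 4) + 3" using A(5) by simp
  ultimately show ?thesis using A(1-3) by blast
qed

text \<open>The count 2 * 2^m * C with 2^m \<le> (2 C/\<epsilon>)^(1/\<alpha>) gives C^(1/\<alpha> +
  1), and C is at most (m + d)^(d-1)/(d-1)!. From 2^\<alpha> - 1 \<le> 1 follows
  \<open>B_const \<alpha>\<close> \<ge> 1, so \<open>K1_const \<alpha>\<close> dominates 4/\<alpha>;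
  being at least 1, it may carry the exponent d instead of d - 1.\<close>

lemma card_sparse_index_bound:
  fixes \<alpha> \<epsilon> :: real
  assumes \<alpha>: "0 < \<alpha>" "\<alpha> \<le> 1" and d: "2 \<le> d" and \<epsilon>: "0 < \<epsilon>" "\<epsilon> < 1"
    and m: "2 powr (\<alpha> * real m) \<le> 2 / \<epsilon> * real ((m + (d - 1)) choose (d - 1))"
    and mL: "real m + real d \<le> 4 / \<alpha> * log 2 (2 / \<epsilon>)"
  shows "real (card (sparse_index d m)) \<le> 2 * 2 powr (1 / \<alpha>) * (K1_const \<alpha> ^ d / fact (d - 1)) powr (1 / \<alpha> + 1)
     * \<epsilon> powr (- (1 / \<alpha>)) * log 2 (2 / \<epsilon>) powr (real (d - 1) * (1 / \<alpha> + 1))"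
proof -
  define L where "L = log 2 (2 / \<epsilon>)"
  define K where "K = K1_const \<alpha>"
  let ?C = "real ((m + (d - 1)) choose (d - 1))"
  have L: "0 < L" unfolding L_def using \<epsilon> by (subst zero_less_log_cancel_iff) (auto simp: field_simps)
  have K: "4 / \<alpha> \<le> K"
  proof -
    have "2 powr \<alpha> - 1 \<le> 2 powr 1 - 1" using \<alpha> by (intro diff_right_mono powr_mono) auto
    moreover have "1 < 2 powr \<alpha>" using \<alpha> by (intro gr_one_powr) auto
    ultimately have "1 \<le> B_const \<alpha>" by (simp add: B_const_def field_simps)
    then have "1 \<le> B_const \<alpha> powr (1 / (\<alpha> + 1))" using \<alpha> by (intro ge_one_powr_ge_zero) auto
    then have "1 * (4 / \<alpha>) \<le> B_const \<alpha> powr (1 / (\<alpha> + 1)) * (4 / \<alpha>)" using \<alpha> by (intro mult_right_mono) auto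
    then show ?thesis by (simp add: K_def K1_const_def field_simps)
  qed
  have K1: "1 \<le> K" using K \<alpha> by (intro order.trans[OF _ K]) (simp add: field_simps)
  have "4 / \<alpha> * L \<le> K * L" using K L by (intro mult_right_mono) auto
  then have mKL: "real m + real d \<le> K * L" using mL by (simp add: L_def)
  have C0: "0 < ?C" by (simp add: zero_less_binomial)
  have "?C * fact (d - 1) \<le> real ((m + (d - 1)) ^ (d - 1))"
    using binomial_fact_pow[of "m + (d - 1)" "d - 1"] by (metis of_nat_fact of_nat_le_iff of_nat_mult)
  also have "\<dots> \<le> (real m + real d) ^ (d - 1)" unfolding of_nat_power by (intro power_mono) auto
  also have "\<dots> \<le> (K * L) ^ (d - 1)"
    using mKL by (intro power_mono) auto
  also have "\<dots> \<le> K ^ d * L ^ (d - 1)"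
    unfolding power_mult_distrib using K1 L by (intro mult_right_mono power_increasing) auto
  finally have C: "?C \<le> K ^ d / fact (d - 1) * L ^ (d - 1)" by (simp add: field_simps)
  obtain d' where d': "d = Suc d'" using d by (cases d) auto
  have "real (card (sparse_index d m)) \<le> real (2 ^ Suc m * ((m + d') choose d'))"
    unfolding d' of_nat_le_iff by (rule card_sparse_index_le)
  also have "\<dots> = 2 * 2 ^ m * ?C" by (simp add: d')
  also have "2 ^ m = (2 powr (\<alpha> * real m)) powr (1 / \<alpha>)" using \<alpha> by (simp add: powr_powr powr_realpow)
  also have "2 * (2 powr (\<alpha> * real m)) powr (1 / \<alpha>) * ?C \<le> 2 * (2 / \<epsilon> * ?C) powr (1 / \<alpha>) * ?C"
    using m \<alpha> by (intro mult_right_mono mult_left_mono powr_mono2) auto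
  also have "\<dots> = 2 * 2 powr (1 / \<alpha>) * \<epsilon> powr (- (1 / \<alpha>)) * ?C powr (1 / \<alpha> + 1)"
    using \<epsilon> C0 by (simp add: powr_mult powr_divide powr_minus_divide powr_add)
  also have "\<dots> \<le> 2 * 2 powr (1 / \<alpha>) * \<epsilon> powr (- (1 / \<alpha>)) * (K ^ d / fact (d - 1) * L ^ (d - 1)) powr (1 / \<alpha> + 1)"
    using C \<alpha> by (intro mult_left_mono powr_mono2) auto
  also have "(K ^ d / fact (d - 1) * L ^ (d - 1)) powr (1 / \<alpha> + 1)
      = (K ^ d / fact (d - 1)) powr (1 / \<alpha> + 1) * L powr (real (d - 1) * (1 / \<alpha> + 1))"
    unfolding powr_realpow[OF L, symmetric] powr_powr[symmetric] by (rule powr_mult)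
  finally show ?thesis by (simp add: L_def K_def mult_ac)
qed

theorem theorem4p1:
  shows "\<exists>C::real. C > 0 \<and> (\<exists>C\<^sub>\<alpha> :: real \<Rightarrow> real. (\<forall>\<alpha>\<in>{0<..1}. C\<^sub>\<alpha> \<alpha> > 0) \<and>
    (\<forall>d\<ge>(2::nat). \<forall>\<alpha>\<in>{0<..1::real}. \<exists>\<epsilon>\<^sub>0\<in>{0<..1::real}. \<forall>\<epsilon>\<in>{0<..<\<epsilon>\<^sub>0}.
      \<exists>A. is_architecture d A \<and> is_deep A \<and> last (net_dims A) = 1 \<and>
        (\<forall>f\<in>U0_ball d \<alpha>. \<exists>\<Phi>. is_network d \<Phi> \<and> is_deep \<Phi> \<and> has_architecture \<Phi> A \<and>
           Linf_norm d (\<lambda>x. f x - vec_index (relu_output \<Phi> x) 0) \<le> ennreal \<epsilon>) \<and>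
        real (net_size A) \<le> C\<^sub>\<alpha> \<alpha> * real d * (K1_const \<alpha> ^ d / fact (d - 1)) powr (1 / \<alpha> + 1)
          * \<epsilon> powr (- (1 / \<alpha>)) * log 2 (2 * inverse \<epsilon>) powr (real (d - 1) * (1 / \<alpha> + 1) + 1) \<and>
        real (net_depth A) \<le> C * log 2 (real d) * log 2 (2 * inverse \<epsilon>)))"
proof (intro exI[of _ "15::real"] conjI exI[of _ "\<lambda>\<alpha>. 578 * 2 powr (1 / \<alpha>)"] ballI allI impI)
  fix d :: nat and \<alpha> :: real
  assume d: "2 \<le> d" and "\<alpha> \<in> {0<..1}"
  then have \<alpha>: "0 < \<alpha>" "\<alpha> \<le> 1" by auto
  obtain \<epsilon>\<^sub>0 where \<epsilon>\<^sub>0: "\<epsilon>\<^sub>0 \<in> {0<..1}" and par: "\<And>\<epsilon>. \<epsilon> \<in> {0<..<\<epsilon>\<^sub>0} \<Longrightarrow> \<exists>m.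
     2 powr (- \<alpha> * real (Suc m)) * real (grid_const d m) \<le> \<epsilon> / 2 \<and>
     2 powr (\<alpha> * real m) \<le> 2 / \<epsilon> * real ((m + (d - 1)) choose (d - 1)) \<and>
     real m + real d \<le> 4 / \<alpha> * log 2 (2 / \<epsilon>) \<and>
     real d * real (Suc m) ^ d \<le> 1 / \<epsilon>"
    using sparse_parameters[OF \<alpha> d] by blast
  \<comment> \<open>The least tree height that accommodates d factors; padding less than doubles
    their number.\<close>
  obtain n' where n': "2 ^ n' < d" "d \<le> 2 ^ (n' + 1)" using ex_power_ivl2[of 2 d] d by auto
  define n where "n = Suc n'"
  have n: "d \<le> 2 ^ n" "2 ^ n \<le> 2 * d" using n' by (auto simp: n_def)
  define D where "D = log 2 (real d)"
  have D1: "1 \<le> D" unfolding D_def using d by (subst le_log_iff) auto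
  have nD: "real n \<le> 2 * D"
  proof -
    have "real n' \<le> D" unfolding D_def using n'(1) d by (subst le_log_iff) (auto simp: powr_realpow)
    then show ?thesis using D1 by (simp add: n_def)
  qed
  show "\<exists>\<epsilon>\<^sub>0\<in>{0<..1::real}. \<forall>\<epsilon>\<in>{0<..<\<epsilon>\<^sub>0}.
      \<exists>A. is_architecture d A \<and> is_deep A \<and> last (net_dims A) = 1 \<and>
        (\<forall>f\<in>U0_ball d \<alpha>. \<exists>\<Phi>. is_network d \<Phi> \<and> is_deep \<Phi> \<and> has_architecture \<Phi> A \<and>
           Linf_norm d (\<lambda>x. f x - vec_index (relu_output \<Phi> x) 0) \<le> ennreal \<epsilon>) \<and>
        real (net_size A) \<le> 578 * 2 powr (1 / \<alpha>) * real d * (K1_const \<alpha> ^ d / fact (d - 1)) powr (1 / \<alpha> + 1)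
          * \<epsilon> powr (- (1 / \<alpha>)) * log 2 (2 * inverse \<epsilon>) powr (real (d - 1) * (1 / \<alpha> + 1) + 1) \<and>
        real (net_depth A) \<le> 15 * log 2 (real d) * log 2 (2 * inverse \<epsilon>)"
  proof (rule bexI[OF _ \<epsilon>\<^sub>0], rule ballI)
    fix \<epsilon> assume \<epsilon>: "\<epsilon> \<in> {0<..<\<epsilon>\<^sub>0}"
    then have e: "0 < \<epsilon>" "\<epsilon> < 1" using \<epsilon>\<^sub>0 by auto
    obtain m where m: "2 powr (- \<alpha> * real (Suc m)) * real (grid_const d m) \<le> \<epsilon> / 2"
        "2 powr (\<alpha> * real m) \<le> 2 / \<epsilon> * real ((m + (d - 1)) choose (d - 1))"
        "real m + real d \<le> 4 / \<alpha> * log 2 (2 / \<epsilon>)" "real d * real (Suc m) ^ d \<le> 1 / \<epsilon>"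
      using par[OF \<epsilon>] by blast
    define L where "L = log 2 (2 / \<epsilon>)"
    have L1: "1 \<le> L" unfolding L_def using e by (subst le_log_iff) (auto simp: field_simps)
    \<comment> \<open>Then 4^(-r) is at most \<epsilon>^2/4. With 2^n \<le> 2d the multiplication
      errors total at most d (m+1)^d \<epsilon>^2/2, which is at most \<epsilon>/2.\<close>
    define r where "r = nat \<lceil>L\<rceil>"
    have r: "L \<le> real r" "real r \<le> 2 * L" using L1 by (auto simp: r_def) linarith
    have r4: "4 / \<epsilon>\<^sup>2 \<le> 4 ^ r"
    proof -
      have "2 / \<epsilon> = 2 powr L" using e by (simp add: L_def)
      also have "\<dots> \<le> 2 powr real r" using r by (intro powr_mono) auto
      also have "\<dots> = 2 ^ r" by (simp add: powr_realpow)
      finally have "(2 / \<epsilon>)\<^sup>2 \<le> (2 ^ r)\<^sup>2" using e by (intro power_mono) auto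
      then show ?thesis by (simp add: power_divide power_even_eq[symmetric] power_mult[symmetric] mult.commute[of r] power_mult[of 2 2])
    qed
    have err2: "real (Suc m) ^ d * (2 ^ n / 4 ^ r) \<le> \<epsilon> / 2"
    proof -
      have "(2::real) ^ n \<le> 2 * real d" using n(2) by (metis of_nat_le_iff of_nat_mult of_nat_numeral of_nat_power)
      then have "2 ^ n / 4 ^ r \<le> 2 * real d / (4 / \<epsilon>\<^sup>2)" using r4 e by (intro frac_le) auto
      then have "real (Suc m) ^ d * (2 ^ n / 4 ^ r) \<le> real (Suc m) ^ d * (2 * real d / (4 / \<epsilon>\<^sup>2))"
        by (intro mult_left_mono) auto
      also have "\<dots> = (real d * real (Suc m) ^ d) * (\<epsilon>\<^sup>2 / 2)" by (simp add: field_simps)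
      also have "\<dots> \<le> 1 / \<epsilon> * (\<epsilon>\<^sup>2 / 2)" using m(4) by (intro mult_right_mono) auto
      also have "\<dots> = \<epsilon> / 2" using e by (simp add: power2_eq_square)
      finally show ?thesis .
    qed
    define N where "N = card (sparse_index d m)"
    obtain A where A: "is_architecture d A" "is_deep A" "last (net_dims A) = 1"
        "net_size A \<le> (6 * (2 ^ n * 3 + (2 ^ n - 1) * (5 * r + 11)) + 1) * N" "net_depth A = n * (r + 4) + 3"
        and \<Phi>: "\<And>c. \<exists>\<Phi>. is_network d \<Phi> \<and> is_deep \<Phi> \<and> has_architecture \<Phi> A \<and>
          (\<lambda>x. relu_output \<Phi> (vec d x) $ 0) \<in> borel_measurable (cube_measure d) \<and>
          (\<forall>x\<in>carrier_vec d. relu_output \<Phi> x $ 0 = (\<Sum>p\<in>sparse_index d m. c p * sparse_net d r n p x))"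
      using sparse_architecture[of d n r m] d unfolding N_def by auto
    have "\<exists>\<Phi>. is_network d \<Phi> \<and> is_deep \<Phi> \<and> has_architecture \<Phi> A \<and>
       Linf_norm d (\<lambda>x. f x - relu_output \<Phi> x $ 0) \<le> ennreal \<epsilon>" if f: "f \<in> U0_ball d \<alpha>" for f
    proof -
      obtain \<Psi> where \<Psi>: "is_network d \<Psi>" "is_deep \<Psi>" "has_architecture \<Psi> A"
          "(\<lambda>x. relu_output \<Psi> (vec d x) $ 0) \<in> borel_measurable (cube_measure d)"
          "\<And>x. x \<in> carrier_vec d \<Longrightarrow> relu_output \<Psi> x $ 0 = (\<Sum>p\<in>sparse_index d m. sparse_coeff p (rev_arg f) * sparse_net d r n p x)"
        using \<Phi>[of "\<lambda>p. sparse_coeff p (rev_arg f)"] by blast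
      have "Linf_norm d (\<lambda>x. f x - relu_output \<Psi> x $ 0) \<le> ennreal \<epsilon>"
      proof (rule Linf_norm_le)
        fix x assume x: "x \<in> cube d"
        then have "x \<in> carrier_vec d" by (simp add: cube_def)
        from \<Psi>(5)[OF this] show "\<bar>f x - relu_output \<Psi> x $ 0\<bar> \<le> \<epsilon>"
          using sparse_net_error[OF f less_imp_le[OF \<alpha>(1)] x n(1), of r m] m(1) err2 by linarith
      qed (use e d \<alpha> \<Psi>(4) U0_ball_measurable[OF f] in auto)
      then show ?thesis using \<Psi>(1-3) by blast
    qed
    moreover have "real (net_size A) \<le> 578 * 2 powr (1 / \<alpha>) * real d * (K1_const \<alpha> ^ d / fact (d - 1)) powr (1 / \<alpha> + 1)
          * \<epsilon> powr (- (1 / \<alpha>)) * log 2 (2 * inverse \<epsilon>) powr (real (d - 1) * (1 / \<alpha> + 1) + 1)"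
    proof -
      have "6 * (2 ^ n * 3 + (2 ^ n - 1) * (5 * r + 11)) + 1 \<le> 6 * (2 ^ n * 3 + 2 ^ n * (5 * r + 11)) + (1::nat)"
        by (intro add_mono mult_left_mono mult_right_mono) auto
      also have "\<dots> = 6 * (2 ^ n * (5 * r + 14)) + 1" by (simp add: algebra_simps)
      also have "\<dots> \<le> 6 * (2 * d * (5 * r + 14)) + 1"
        by (intro add_mono mult_left_mono mult_right_mono n(2)) auto
      finally have "net_size A \<le> (6 * (2 * d * (5 * r + 14)) + 1) * N"
        by (intro order.trans[OF A(4)] mult_right_mono) auto
      then have "real (net_size A) \<le> real ((6 * (2 * d * (5 * r + 14)) + 1) * N)" by (simp only: of_nat_le_iff)
      also have "\<dots> = (12 * (real d * (5 * real r + 14)) + 1) * real N" by (simp add: algebra_simps)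
      also have "\<dots> \<le> (289 * (real d * L)) * real N"
      proof (intro mult_right_mono)
        \<comment> \<open>From r \<le> 2L and 1 \<le> L: 5r + 14 \<le> 24L. Then 12 * 24 + 1 = 289,
          and the factor 2 of the grid count makes it 578.\<close>
        have "real d * (5 * real r + 14) \<le> real d * (24 * L)" using r L1 by (intro mult_left_mono) auto
        moreover have "1 * 1 \<le> real d * L" using d L1 by (intro mult_mono) auto
        ultimately show "12 * (real d * (5 * real r + 14)) + 1 \<le> 289 * (real d * L)" by simp
      qed simp
      also have "\<dots> \<le> (289 * (real d * L)) * (2 * 2 powr (1 / \<alpha>) * (K1_const \<alpha> ^ d / fact (d - 1)) powr (1 / \<alpha> + 1)
          * \<epsilon> powr (- (1 / \<alpha>)) * L powr (real (d - 1) * (1 / \<alpha> + 1)))"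
        unfolding N_def L_def using card_sparse_index_bound[OF \<alpha> d e m(2,3)] L1
        by (intro mult_left_mono) (auto simp: L_def)
      also have "\<dots> = 578 * 2 powr (1 / \<alpha>) * real d * (K1_const \<alpha> ^ d / fact (d - 1)) powr (1 / \<alpha> + 1)
          * \<epsilon> powr (- (1 / \<alpha>)) * L powr (real (d - 1) * (1 / \<alpha> + 1) + 1)"
        using L1 by (simp add: powr_add)
      finally show ?thesis by (simp add: L_def divide_inverse)
    qed
    moreover have "real (net_depth A) \<le> 15 * log 2 (real d) * log 2 (2 * inverse \<epsilon>)"
    proof -
      have "real (net_depth A) = real n * (real r + 4) + 3" by (simp add: A(5))
      \<comment> \<open>Here n \<le> 2D and r + 4 \<le> 6L, so the depth constant is 12 + 3 =
        15.\<close>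
      also have "\<dots> \<le> 2 * D * (6 * L) + 3 * (D * L)"
      proof (intro add_mono mult_mono nD)
        have "1 * 1 \<le> D * L" using D1 L1 by (intro mult_mono) auto
        then show "3 \<le> 3 * (D * L)" by simp
      qed (use r L1 D1 in auto)
      also have "\<dots> = 15 * D * L" by simp
      finally show ?thesis by (simp add: D_def L_def divide_inverse)
    qed
    ultimately show "\<exists>A. is_architecture d A \<and> is_deep A \<and> last (net_dims A) = 1 \<and>
        (\<forall>f\<in>U0_ball d \<alpha>. \<exists>\<Phi>. is_network d \<Phi> \<and> is_deep \<Phi> \<and> has_architecture \<Phi> A \<and>
           Linf_norm d (\<lambda>x. f x - vec_index (relu_output \<Phi> x) 0) \<le> ennreal \<epsilon>) \<and>
        real (net_size A) \<le> 578 * 2 powr (1 / \<alpha>) * real d * (K1_const \<alpha> ^ d / fact (d - 1)) powr (1 / \<alpha> + 1)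
          * \<epsilon> powr (- (1 / \<alpha>)) * log 2 (2 * inverse \<epsilon>) powr (real (d - 1) * (1 / \<alpha> + 1) + 1) \<and>
        real (net_depth A) \<le> 15 * log 2 (real d) * log 2 (2 * inverse \<epsilon>)"
      using A(1-3) by blast
  qed
qed auto

end
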